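(* Let $(\mathcal{C},G,\varphi)$ be a category system with $\mathcal{C}$ a finitely aligned left cancellative small category, let $\mathcal{D}=\mathcal{C}\rtimes^\varphi G$ be its Zappa-Szép product, and let $B$ be a $C^*$-algebra. There is a bijective correspondence $(T,U)\mapsto R$ between representations $(T,U)$ of $(\mathcal{C},G,\varphi)$ in $B$ and nondegenerate representations $R$ of $\mathcal{D}$ in $B$, given as follows: (i) If $(T,U)$ is a representation of $(\mathcal{C},G,\varphi)$ in $B$, then $R\colon\mathcal{D}\to B$ is defined by $R_{(\alpha,g)}=T_\alpha U_g$. (ii) If $R\colon\mathcal{D}\to B$ is a nondegenerate representation, then $(T,U)$ is defined by $T_\alpha=R_{(\alpha,1)}$ and $U_g=\sum_{v\in\mathcal{C}^0}R_{(v,g)}$, where the series converges strictly in $M(B)$.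
   Context: Small categories: a small category $\mathcal{C}$ is identified with its set of morphisms; $\mathcal{C}^0\subseteq\mathcal{C}$ (nonempty) is the set of vertices (objects, identified with identity morphisms), $r,s\colon\mathcal{C}\to\mathcal{C}^0$ are the range and source maps, and $\alpha\beta$ is defined iff $s(\alpha)=r(\beta)$. $\mathcal{C}$ is left cancellative if $\alpha\beta=\alpha\gamma$ implies $\beta=\gamma$. Write $\alpha\mathcal{C}=\{\alpha\beta: r(\beta)=s(\alpha)\}$ and, for $v\in\mathcal{C}^0$, $v\mathcal{C}=r^{-1}(v)$. $\mathcal{C}$ is finitely aligned if for all $\alpha,\beta\in\mathcal{C}$ there is a finite (possibly empty) $F\subseteq\mathcal{C}$ with $\alpha\mathcal{C}\cap\beta\mathcal{C}=\bigcup_{\gamma\in F}\gamma\mathcal{C}$. A set $F$ is independent if $\gamma\notin\gamma'\mathcal{C}$ for all distinct $\gamma,\gamma'\in F$. One writes $\alpha\vee\beta$ for any finite independent $F$ with $\alpha\mathcal{C}\cap\beta\mathcal{C}=\bigcup_{\gamma\in F}\gamma\mathcal{C}$; it is unique up to replacing elements $\gamma$ by $\gamma\delta$ with $\delta$ invertible. Representations: a representation of a finitely aligned left cancellative small category $\mathcal{C}$ in a $C^*$-algebra $B$ is a map $T\colon\mathcal{C}\to B$ such that for all $\alpha,\beta\in\mathcal{C}$: (1) $T_\alpha^*T_\alpha=T_{s(\alpha)}$; (2) $T_\alpha T_\beta=T_{\alpha\beta}$ if $s(\alpha)=r(\beta)$; (3) $T_\alpha T_\alpha^*T_\beta T_\beta^*=\bigvee_{\gamma\in\alpha\vee\beta}T_\gamma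 T_\gamma^*$ (join of projections, a priori taken in $B^{**}$; the empty join is $0$). $T$ is nondegenerate if $\sum_{v\in\mathcal{C}^0}T_v$ converges strictly to $1$ in the multiplier algebra $M(B)$. Category systems: $G$ is a discrete group acting on the set $\mathcal{C}$ by permutations, with $r(g\alpha)=gr(\alpha)$ and $s(g\alpha)=gs(\alpha)$ (not necessarily by automorphisms of the category). A category cocycle is a map $\varphi\colon G\times\mathcal{C}\to G$ such that $\varphi(gh,\alpha)=\varphi(g,h\alpha)\varphi(h,\alpha)$ for all $g,h\in G$, $\alpha\in\mathcal{C}$, and, for all $g\in G$, $v\in\mathcal{C}^0$ and $\alpha,\beta\in\mathcal{C}$ with $s(\alpha)=r(\beta)$: $\varphi(g,v)=g$; $\varphi(g,\alpha)s(\alpha)=gs(\alpha)$; $g(\alpha\beta)=(g\alpha)(\varphi(g,\alpha)\beta)$; $\varphi(g,\alpha\beta)=\varphi(\varphi(g,\alpha),\beta)$. Then $(\mathcal{C},G,\varphi)$ is called a category system. Zappa-Szép product: $\mathcal{D}=\mathcal{C}\rtimes^\varphi G$ is the set $\mathcal{C}\times G$ with $\mathcal{D}^0=\mathcal{C}^0\times\{1\}$, $r(\alpha,g)=(r(\alpha),1)$, $s(\alpha,g)=(g^{-1}s(\alpha),1)$ and $(\alpha,g)(\beta,h)=(\alpha(g\beta),\varphi(g,\beta)h)$ whenever $s(\alpha,g)=r(\beta,h)$. It is a finitely aligned left cancellative small category when $\mathcal{C}$ is. A representation of the category system $(\mathcal{C},G,\varphi)$ in $B$ is a pair $(T,U)$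 where $T\colon\mathcal{C}\to B$ is a nondegenerate representation and $U\colon G\to M(B)$ is a unitary representation (a homomorphism into the unitary group of $M(B)$) such that $U_gT_\alpha=T_{g\alpha}U_{\varphi(g,\alpha)}$ for all $g\in G$, $\alpha\in\mathcal{C}$. *)

theory Defs
  imports "HOL-Analysis.Analysis" "HOL-Algebra.Group_Action"
begin

class star =
  fixes star :: "'a \<Rightarrow> 'a"  ("_\<^sup>\<star>" [1000] 999)

text \<open>Neither a unit nor nontriviality is assumed.\<close>

class cstar_algebra = banach + real_normed_algebra + star +
  fixes scaleC :: "complex \<Rightarrow> 'a \<Rightarrow> 'a"  (infixr "*\<^sub>C" 75)
  assumes scaleC_add_right: "c *\<^sub>C (x + y) = c *\<^sub>C x + c *\<^sub>C y"
    and scaleC_add_left: "(c + d) *\<^sub>C x = c *\<^sub>C x + d *\<^sub>C x"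
    and scaleC_scaleC: "c *\<^sub>C (d *\<^sub>C x) = (c * d) *\<^sub>C x"
    and scaleR_scaleC: "r *\<^sub>R x = complex_of_real r *\<^sub>C x"
    and norm_scaleC: "norm (c *\<^sub>C x) = cmod c * norm x"
    and scaleC_mult_left: "(c *\<^sub>C x) * y = c *\<^sub>C (x * y)"
    and scaleC_mult_right: "x * (c *\<^sub>C y) = c *\<^sub>C (x * y)"
    and star_star: "(x\<^sup>\<star>)\<^sup>\<star> = x"
    and star_add: "(x + y)\<^sup>\<star> = x\<^sup>\<star> + y\<^sup>\<star>"
    and star_mult: "(x * y)\<^sup>\<star> = y\<^sup>\<star> * x\<^sup>\<star>"
    and star_scaleC: "(c *\<^sub>C x)\<^sup>\<star> = cnj c *\<^sub>C x\<^sup>\<star>"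
    and cstar_identity: "norm (x\<^sup>\<star> * x) = (norm x)\<^sup>2"

lemma star_zero: "(0 :: 'b::cstar_algebra)\<^sup>\<star> = 0"
  by (metis add_cancel_right_right star_add)

lemma cstar_eq_0_if_left:
  fixes x :: "'b::cstar_algebra"
  assumes "\<And>a. a * x = 0"
  shows "x = 0"
  using cstar_identity[of x] assms by simp

lemma cstar_eq_0_if_right:
  fixes x :: "'b::cstar_algebra"
  assumes "\<And>a. x * a = 0"
  shows "x = 0"
proof -
  have "x\<^sup>\<star> = 0"
    using cstar_identity[of "x\<^sup>\<star>"] assms by (simp add: star_star)
  then show ?thesis
    by (metis star_star star_zero)
qed

lemma cstar_eqI_left:
  fixes x y :: "'b::cstar_algebra"
  assumes "\<And>a. a * x = a * y"
  shows "x = y"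
  using cstar_eq_0_if_left[of "x - y"] assms by (simp add: right_diff_distrib)

lemma cstar_eqI_right:
  fixes x y :: "'b::cstar_algebra"
  assumes "\<And>a. x * a = y * a"
  shows "x = y"
  using cstar_eq_0_if_right[of "x - y"] assms by (simp add: left_diff_distrib)

text \<open>
  The multiplier algebra as the algebra of double centralizers \<open>(L, R)\<close>, in Busby's form: for a
  C*-algebra, the identity \<open>a (L b) = (R a) b\<close> alone forces \<open>L\<close> and \<open>R\<close> to be linear, bounded and
  module maps.
\<close>

typedef (overloaded) 'b multiplier =
  "{(L, R). \<forall>a b. a * L b = R a * b} :: (('b::cstar_algebra \<Rightarrow> 'b) \<times> ('b \<Rightarrow> 'b)) set"
  by (rule exI[of _ "(id, id)"]) simp

setup_lifting type_definition_multiplier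

lift_definition lmul :: "'b::cstar_algebra multiplier \<Rightarrow> 'b \<Rightarrow> 'b" is fst .
lift_definition rmul :: "'b::cstar_algebra \<Rightarrow> 'b multiplier \<Rightarrow> 'b" is "\<lambda>b m. snd m b" .

lemma mult_lmul: "a * lmul m b = rmul a m * b"
  by transfer auto

lemma multiplier_eqI:
  assumes "\<And>b. lmul m b = lmul n b" "\<And>b. rmul b m = rmul b n"
  shows "m = n"
  using assms by transfer (auto simp: prod_eq_iff)

lemma lmul_add: "lmul m (a + b) = lmul m a + lmul m b"
  by (rule cstar_eqI_left) (simp add: mult_lmul distrib_left)

lemma rmul_add: "rmul (a + b) m = rmul a m + rmul b m"
  by (rule cstar_eqI_right) (simp add: mult_lmul[symmetric] distrib_right)

instantiation multiplier :: (cstar_algebra) "{ring, monoid_mult, star}"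
begin

lift_definition zero_multiplier :: "'a multiplier" is "(\<lambda>_. 0, \<lambda>_. 0)" by simp
lift_definition one_multiplier :: "'a multiplier" is "(\<lambda>b. b, \<lambda>b. b)" by simp
lift_definition plus_multiplier :: "'a multiplier \<Rightarrow> 'a multiplier \<Rightarrow> 'a multiplier"
  is "\<lambda>(L, R) (L', R'). (\<lambda>b. L b + L' b, \<lambda>b. R b + R' b)"
  by (auto simp: algebra_simps)
lift_definition minus_multiplier :: "'a multiplier \<Rightarrow> 'a multiplier \<Rightarrow> 'a multiplier"
  is "\<lambda>(L, R) (L', R'). (\<lambda>b. L b - L' b, \<lambda>b. R b - R' b)"
  by (auto simp: algebra_simps)
lift_definition uminus_multiplier :: "'a multiplier \<Rightarrow> 'a multiplier"
  is "\<lambda>(L, R). (\<lambda>b. - L b, \<lambda>b. - R b)"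
  by auto
lift_definition times_multiplier :: "'a multiplier \<Rightarrow> 'a multiplier \<Rightarrow> 'a multiplier"
  is "\<lambda>(L, R) (L', R'). (\<lambda>b. L (L' b), \<lambda>b. R' (R b))"
  by auto
lift_definition star_multiplier :: "'a multiplier \<Rightarrow> 'a multiplier"
  is "\<lambda>(L, R). (\<lambda>b. (R (b\<^sup>\<star>))\<^sup>\<star>, \<lambda>b. (L (b\<^sup>\<star>))\<^sup>\<star>)"
  by clarsimp (metis star_mult star_star)

instance
proof
  fix a b c :: "'a multiplier"
  show "a + b + c = a + (b + c)" by transfer (auto simp: add.assoc)
  show "a + b = b + a" by transfer (auto simp: add.commute)
  show "0 + a = a" by transfer auto
  show "- a + a = 0" by transfer auto
  show "a - b = a + - b" by transfer auto
  show "a * b * c = a * (b * c)" by transfer auto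
  show "1 * a = a" by transfer auto
  show "a * 1 = a" by transfer auto
  have l: "lmul (x + y) d = lmul x d + lmul y d" and r: "rmul d (x + y) = rmul d x + rmul d y"
    and lm: "lmul (x * y) d = lmul x (lmul y d)" and rm: "rmul d (x * y) = rmul (rmul d x) y"
    for x y :: "'a multiplier" and d
    by (transfer, auto)+
  show "(a + b) * c = a * c + b * c"
    by (rule multiplier_eqI) (simp_all add: l r lm rm rmul_add)
  show "a * (b + c) = a * b + a * c"
    by (rule multiplier_eqI) (simp_all add: l r lm rm lmul_add)
qed

end

lemma lmul_simps:
  "lmul 0 b = 0" "lmul 1 b = b" "lmul (m + n) b = lmul m b + lmul n b"
  "lmul (m * n) b = lmul m (lmul n b)" "lmul (m\<^sup>\<star>) b = (rmul (b\<^sup>\<star>) m)\<^sup>\<star>"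
  by (transfer, auto)+

lemma rmul_simps:
  "rmul b 0 = 0" "rmul b 1 = b" "rmul b (m + n) = rmul b m + rmul b n"
  "rmul b (m * n) = rmul (rmul b m) n" "rmul b (m\<^sup>\<star>) = (lmul m (b\<^sup>\<star>))\<^sup>\<star>"
  by (transfer, auto)+

lift_definition embM :: "'b::cstar_algebra \<Rightarrow> 'b multiplier"
  is "\<lambda>b. (\<lambda>x. b * x, \<lambda>x. x * b)"
  by (auto simp: mult.assoc)

lemma lmul_embM: "lmul (embM b) x = b * x"
  by transfer simp

lemma rmul_embM: "rmul x (embM b) = x * b"
  by transfer simp

lemma embM_lmul: "embM (lmul m b) = m * embM b"
proof (rule multiplier_eqI)
  fix x
  show "lmul (embM (lmul m b)) x = lmul (m * embM b) x"
    by (rule cstar_eqI_left) (simp add: lmul_simps lmul_embM mult_lmul mult.assoc[symmetric])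
  show "rmul x (embM (lmul m b)) = rmul x (m * embM b)"
    by (simp add: rmul_simps rmul_embM mult_lmul)
qed

lemma embM_rmul: "embM (rmul b m) = embM b * m"
proof (rule multiplier_eqI)
  fix x
  show "lmul (embM (rmul b m)) x = lmul (embM b * m) x"
    by (simp add: lmul_simps lmul_embM mult_lmul)
  show "rmul x (embM (rmul b m)) = rmul x (embM b * m)"
    by (rule cstar_eqI_right) (simp add: rmul_simps rmul_embM mult_lmul[symmetric] mult.assoc)
qed

lemma embM_inject: "embM a = embM b \<longleftrightarrow> a = b"
  by (metis cstar_eqI_left rmul_embM)

definition strict_tendsto ::
  "('i \<Rightarrow> 'b::cstar_algebra multiplier) \<Rightarrow> 'b multiplier \<Rightarrow> 'i filter \<Rightarrow> bool" where
  "strict_tendsto f m F \<longleftrightarrow>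
     (\<forall>b. ((\<lambda>i. lmul (f i) b) \<longlongrightarrow> lmul m b) F \<and> ((\<lambda>i. rmul b (f i)) \<longlongrightarrow> rmul b m) F)"

definition strict_has_sum ::
  "('i \<Rightarrow> 'b::cstar_algebra multiplier) \<Rightarrow> 'b multiplier \<Rightarrow> 'i set \<Rightarrow> bool" where
  "strict_has_sum f m A \<longleftrightarrow> strict_tendsto (sum f) m (finite_subsets_at_top A)"

definition strict_summable :: "('i \<Rightarrow> 'b::cstar_algebra multiplier) \<Rightarrow> 'i set \<Rightarrow> bool" where
  "strict_summable f A \<longleftrightarrow> (\<exists>m. strict_has_sum f m A)"

definition strict_sum :: "('i \<Rightarrow> 'b::cstar_algebra multiplier) \<Rightarrow> 'i set \<Rightarrow> 'b multiplier" where
  "strict_sum f A = (THE m. strict_has_sum f m A)"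

lemma strict_has_sum_unique:
  assumes "strict_has_sum f m A" "strict_has_sum f n A"
  shows "m = n"
proof (rule multiplier_eqI)
  fix b
  show "lmul m b = lmul n b" "rmul b m = rmul b n"
    using assms unfolding strict_has_sum_def strict_tendsto_def
    by (meson finite_subsets_at_top_neq_bot tendsto_unique)+
qed

lemma strict_sum_eqI: "strict_has_sum f m A \<Longrightarrow> strict_sum f A = m"
  unfolding strict_sum_def by (blast intro: strict_has_sum_unique)

definition unitary_group :: "'b::cstar_algebra multiplier monoid" where
  "unitary_group = \<lparr>carrier = {u. u\<^sup>\<star> * u = 1 \<and> u * u\<^sup>\<star> = 1}, mult = (*), one = 1\<rparr>"

text \<open>
  \<open>B**\<close> is the Banach space bidual with the Arens product and the adjoint extending those of \<open>B\<close>
  (Sherman--Takeda: this is the enveloping von Neumann algebra). Functionals on the dual space are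
  made extensional, so that equality in \<open>B**\<close> is equality of functions.
\<close>

definition dual :: "('b::cstar_algebra \<Rightarrow> complex) set" where
  "dual = {f. bounded_linear f \<and> (\<forall>c x. f (c *\<^sub>C x) = c * f x)}"

definition bidual :: "(('b::cstar_algebra \<Rightarrow> complex) \<Rightarrow> complex) set" where
  "bidual = {F \<in> extensional dual.
     (\<forall>f\<in>dual. \<forall>g\<in>dual. F (\<lambda>x. f x + g x) = F f + F g) \<and>
     (\<forall>c. \<forall>f\<in>dual. F (\<lambda>x. c * f x) = c * F f) \<and>
     (\<exists>K. \<forall>f\<in>dual. cmod (F f) \<le> K * onorm f)}"

definition bidual_emb :: "'b::cstar_algebra \<Rightarrow> ('b \<Rightarrow> complex) \<Rightarrow> complex" where
  "bidual_emb b = (\<lambda>f\<in>dual. f b)"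

definition arens ::
  "(('b::cstar_algebra \<Rightarrow> complex) \<Rightarrow> complex) \<Rightarrow> (('b \<Rightarrow> complex) \<Rightarrow> complex) \<Rightarrow>
   ('b \<Rightarrow> complex) \<Rightarrow> complex" where
  "arens F G = (\<lambda>f\<in>dual. F (\<lambda>a. G (\<lambda>b. f (a * b))))"

definition bidual_star ::
  "(('b::cstar_algebra \<Rightarrow> complex) \<Rightarrow> complex) \<Rightarrow> ('b \<Rightarrow> complex) \<Rightarrow> complex" where
  "bidual_star F = (\<lambda>f\<in>dual. cnj (F (\<lambda>a. cnj (f (a\<^sup>\<star>)))))"

lemma dual_mult_right: "f \<in> dual \<Longrightarrow> (\<lambda>x. f (x * b)) \<in> dual"
  and dual_mult_left: "f \<in> dual \<Longrightarrow> (\<lambda>x. f (b * x)) \<in> dual"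
  for b :: "'b::cstar_algebra"
  using bounded_linear_compose[OF _ bounded_linear_mult_left[of b], of f]
    bounded_linear_compose[OF _ bounded_linear_mult_right[of b], of f]
  by (auto simp: dual_def scaleC_mult_left scaleC_mult_right)

lemma bounded_linear_star: "bounded_linear (star :: 'b::cstar_algebra \<Rightarrow> 'b)"
proof (rule bounded_linear_intro[where K = 1])
  fix x :: 'b
  have le: "norm y \<le> norm (y\<^sup>\<star>)" for y :: 'b
  proof (cases "y = 0")
    case False
    have "norm y * norm y \<le> norm (y\<^sup>\<star>) * norm y"
      using norm_mult_ineq[of "y\<^sup>\<star>" y] by (simp add: cstar_identity power2_eq_square)
    with False show ?thesis by simp
  qed simp
  show "norm (x\<^sup>\<star>) \<le> norm x * 1"
    using le[of "x\<^sup>\<star>"] by (simp add: star_star)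
qed (simp_all add: star_add scaleR_scaleC star_scaleC)

lemma dual_star:
  assumes "f \<in> dual"
  shows "(\<lambda>a. cnj (f (a\<^sup>\<star>))) \<in> dual"
  using assms bounded_linear_compose[OF bounded_linear_cnj
      bounded_linear_compose[OF _ bounded_linear_star, of f]]
  by (auto simp: dual_def star_scaleC)

lemma bidual_emb_bidual: "bidual_emb b \<in> bidual"
proof -
  have add: "(\<lambda>x. f x + g x) \<in> dual" if "f \<in> dual" "g \<in> dual" for f g :: "'a \<Rightarrow> complex"
    using that by (auto simp: dual_def bounded_linear_add algebra_simps)
  have scale: "(\<lambda>x. c * f x) \<in> dual" if "f \<in> dual" for c and f :: "'a \<Rightarrow> complex"
    using that by (auto simp: dual_def intro: bounded_linear_const_mult)
  have "\<forall>f\<in>dual. cmod (bidual_emb b f) \<le> norm b * onorm f"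
    by (auto simp: bidual_emb_def dual_def mult.commute[of "norm b"] intro: onorm)
  then show ?thesis
    unfolding bidual_def using add scale by (auto simp: bidual_emb_def)
qed

lemma arens_emb: "arens (bidual_emb a) (bidual_emb b) = bidual_emb (a * b)"
  by (rule ext) (simp add: arens_def bidual_emb_def restrict_def dual_mult_left dual_mult_right)

lemma bidual_star_emb: "bidual_star (bidual_emb a) = bidual_emb (a\<^sup>\<star>)"
  by (rule ext) (simp add: bidual_star_def bidual_emb_def restrict_def dual_star)

definition bidual_proj :: "(('b::cstar_algebra \<Rightarrow> complex) \<Rightarrow> complex) set" where
  "bidual_proj = {P \<in> bidual. arens P P = P \<and> bidual_star P = P}"

definition bidual_proj_le ::
  "(('b::cstar_algebra \<Rightarrow> complex) \<Rightarrow> complex) \<Rightarrow> (('b \<Rightarrow> complex) \<Rightarrow> complex) \<Rightarrow> bool" where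
  "bidual_proj_le P Q \<longleftrightarrow> arens P Q = P"

definition is_bidual_join ::
  "(('b::cstar_algebra \<Rightarrow> complex) \<Rightarrow> complex) set \<Rightarrow> (('b \<Rightarrow> complex) \<Rightarrow> complex) \<Rightarrow> bool" where
  "is_bidual_join S P \<longleftrightarrow> P \<in> bidual_proj \<and> (\<forall>Q\<in>S. bidual_proj_le Q P) \<and>
     (\<forall>P'\<in>bidual_proj. (\<forall>Q\<in>S. bidual_proj_le Q P') \<longrightarrow> bidual_proj_le P P')"

text \<open>\<open>cmp C \<alpha> \<beta>\<close> is only meaningful if \<open>src C \<alpha> = rng C \<beta>\<close>.\<close>

record 'c smallcat =
  Mor :: "'c set"
  Obj :: "'c set"
  rng :: "'c \<Rightarrow> 'c"
  src :: "'c \<Rightarrow> 'c"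
  cmp :: "'c \<Rightarrow> 'c \<Rightarrow> 'c"

locale small_category =
  fixes C :: "'c smallcat"
  assumes Obj_Mor: "Obj C \<subseteq> Mor C"
    and Obj_nonempty: "Obj C \<noteq> {}"
    and rng_closed: "\<alpha> \<in> Mor C \<Longrightarrow> rng C \<alpha> \<in> Obj C"
    and src_closed: "\<alpha> \<in> Mor C \<Longrightarrow> src C \<alpha> \<in> Obj C"
    and rng_Obj: "v \<in> Obj C \<Longrightarrow> rng C v = v"
    and src_Obj: "v \<in> Obj C \<Longrightarrow> src C v = v"
    and cmp_closed: "\<lbrakk>\<alpha> \<in> Mor C; \<beta> \<in> Mor C; src C \<alpha> = rng C \<beta>\<rbrakk> \<Longrightarrow> cmp C \<alpha> \<beta> \<in> Mor C"
    and rng_cmp: "\<lbrakk>\<alpha> \<in> Mor C; \<beta> \<in> Mor C; src C \<alpha> = rng C \<beta>\<rbrakk> \<Longrightarrow> rng C (cmp C \<alpha> \<beta>) = rng C \<alpha>"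
    and src_cmp: "\<lbrakk>\<alpha> \<in> Mor C; \<beta> \<in> Mor C; src C \<alpha> = rng C \<beta>\<rbrakk> \<Longrightarrow> src C (cmp C \<alpha> \<beta>) = src C \<beta>"
    and cmp_assoc: "\<lbrakk>\<alpha> \<in> Mor C; \<beta> \<in> Mor C; \<gamma> \<in> Mor C; src C \<alpha> = rng C \<beta>; src C \<beta> = rng C \<gamma>\<rbrakk>
      \<Longrightarrow> cmp C (cmp C \<alpha> \<beta>) \<gamma> = cmp C \<alpha> (cmp C \<beta> \<gamma>)"
    and rng_cmp_id: "\<alpha> \<in> Mor C \<Longrightarrow> cmp C (rng C \<alpha>) \<alpha> = \<alpha>"
    and cmp_src_id: "\<alpha> \<in> Mor C \<Longrightarrow> cmp C \<alpha> (src C \<alpha>) = \<alpha>"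

definition left_cancellative :: "'c smallcat \<Rightarrow> bool" where
  "left_cancellative C \<longleftrightarrow> (\<forall>\<alpha>\<in>Mor C. \<forall>\<beta>\<in>Mor C. \<forall>\<gamma>\<in>Mor C.
     src C \<alpha> = rng C \<beta> \<and> src C \<alpha> = rng C \<gamma> \<and> cmp C \<alpha> \<beta> = cmp C \<alpha> \<gamma> \<longrightarrow> \<beta> = \<gamma>)"

definition right_ideal :: "'c smallcat \<Rightarrow> 'c \<Rightarrow> 'c set" where
  "right_ideal C \<alpha> = {cmp C \<alpha> \<beta> | \<beta>. \<beta> \<in> Mor C \<and> rng C \<beta> = src C \<alpha>}"

definition finitely_aligned :: "'c smallcat \<Rightarrow> bool" where
  "finitely_aligned C \<longleftrightarrow> (\<forall>\<alpha>\<in>Mor C. \<forall>\<beta>\<in>Mor C. \<exists>F. finite F \<and> F \<subseteq> Mor C \<and>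
     right_ideal C \<alpha> \<inter> right_ideal C \<beta> = (\<Union>\<gamma>\<in>F. right_ideal C \<gamma>))"

definition independent_mor :: "'c smallcat \<Rightarrow> 'c set \<Rightarrow> bool" where
  "independent_mor C F \<longleftrightarrow> (\<forall>\<gamma>\<in>F. \<forall>\<gamma>'\<in>F. \<gamma> \<noteq> \<gamma>' \<longrightarrow> \<gamma> \<notin> right_ideal C \<gamma>')"

text \<open>
  The set \<open>\<alpha> \<or> \<beta>\<close> is only determined up to invertibles; \<open>is_vee C \<alpha> \<beta> F\<close> says that \<open>F\<close> is one of the
  possible choices.
\<close>

definition is_vee :: "'c smallcat \<Rightarrow> 'c \<Rightarrow> 'c \<Rightarrow> 'c set \<Rightarrow> bool" where
  "is_vee C \<alpha> \<beta> F \<longleftrightarrow> finite F \<and> F \<subseteq> Mor C \<and> independent_mor C F \<and>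
     right_ideal C \<alpha> \<inter> right_ideal C \<beta> = (\<Union>\<gamma>\<in>F. right_ideal C \<gamma>)"

text \<open>Representations are extensional functions, so that equal ones are equal as functions.\<close>

definition cat_rep :: "'c smallcat \<Rightarrow> ('c \<Rightarrow> 'b::cstar_algebra) \<Rightarrow> bool" where
  "cat_rep C T \<longleftrightarrow> T \<in> extensional (Mor C) \<and>
     (\<forall>\<alpha>\<in>Mor C. (T \<alpha>)\<^sup>\<star> * T \<alpha> = T (src C \<alpha>)) \<and>
     (\<forall>\<alpha>\<in>Mor C. \<forall>\<beta>\<in>Mor C. src C \<alpha> = rng C \<beta> \<longrightarrow> T \<alpha> * T \<beta> = T (cmp C \<alpha> \<beta>)) \<and>
     (\<forall>\<alpha>\<in>Mor C. \<forall>\<beta>\<in>Mor C. \<forall>F. is_vee C \<alpha> \<beta> F \<longrightarrow>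
        is_bidual_join ((\<lambda>\<gamma>. bidual_emb (T \<gamma> * (T \<gamma>)\<^sup>\<star>)) ` F)
          (bidual_emb (T \<alpha> * (T \<alpha>)\<^sup>\<star> * T \<beta> * (T \<beta>)\<^sup>\<star>)))"

definition nondegenerate :: "'c smallcat \<Rightarrow> ('c \<Rightarrow> 'b::cstar_algebra) \<Rightarrow> bool" where
  "nondegenerate C T \<longleftrightarrow> strict_has_sum (\<lambda>v. embM (T v)) 1 (Obj C)"

definition nondeg_reps :: "'c smallcat \<Rightarrow> ('c \<Rightarrow> 'b::cstar_algebra) set" where
  "nondeg_reps C = {T. cat_rep C T \<and> nondegenerate C T}"

text \<open>\<open>act g\<close> is a permutation of \<open>Mor C\<close>, not necessarily a category automorphism.\<close>

locale category_system =
  small_category C + group_action G "Mor C" act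
  for C :: "'c smallcat" and G :: "'g monoid" (structure) and act :: "'g \<Rightarrow> 'c \<Rightarrow> 'c" +
  fixes \<phi> :: "'g \<Rightarrow> 'c \<Rightarrow> 'g"
  assumes rng_act: "\<lbrakk>g \<in> carrier G; \<alpha> \<in> Mor C\<rbrakk> \<Longrightarrow> rng C (act g \<alpha>) = act g (rng C \<alpha>)"
    and src_act: "\<lbrakk>g \<in> carrier G; \<alpha> \<in> Mor C\<rbrakk> \<Longrightarrow> src C (act g \<alpha>) = act g (src C \<alpha>)"
    and cocycle_closed: "\<lbrakk>g \<in> carrier G; \<alpha> \<in> Mor C\<rbrakk> \<Longrightarrow> \<phi> g \<alpha> \<in> carrier G"
    and cocycle_mult: "\<lbrakk>g \<in> carrier G; h \<in> carrier G; \<alpha> \<in> Mor C\<rbrakk>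
      \<Longrightarrow> \<phi> (g \<otimes> h) \<alpha> = \<phi> g (act h \<alpha>) \<otimes> \<phi> h \<alpha>"
    and cocycle_Obj: "\<lbrakk>g \<in> carrier G; v \<in> Obj C\<rbrakk> \<Longrightarrow> \<phi> g v = g"
    and cocycle_src: "\<lbrakk>g \<in> carrier G; \<alpha> \<in> Mor C\<rbrakk> \<Longrightarrow> act (\<phi> g \<alpha>) (src C \<alpha>) = act g (src C \<alpha>)"
    and act_cmp: "\<lbrakk>g \<in> carrier G; \<alpha> \<in> Mor C; \<beta> \<in> Mor C; src C \<alpha> = rng C \<beta>\<rbrakk>
      \<Longrightarrow> act g (cmp C \<alpha> \<beta>) = cmp C (act g \<alpha>) (act (\<phi> g \<alpha>) \<beta>)"
    and cocycle_cmp: "\<lbrakk>g \<in> carrier G; \<alpha> \<in> Mor C; \<beta> \<in> Mor C; src C \<alpha> = rng C \<beta>\<rbrakk>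
      \<Longrightarrow> \<phi> g (cmp C \<alpha> \<beta>) = \<phi> (\<phi> g \<alpha>) \<beta>"

definition zappa_szep ::
  "'c smallcat \<Rightarrow> 'g monoid \<Rightarrow> ('g \<Rightarrow> 'c \<Rightarrow> 'c) \<Rightarrow> ('g \<Rightarrow> 'c \<Rightarrow> 'g) \<Rightarrow> ('c \<times> 'g) smallcat" where
  "zappa_szep C G act \<phi> =
    \<lparr>Mor = Mor C \<times> carrier G,
     Obj = Obj C \<times> {\<one>\<^bsub>G\<^esub>},
     rng = (\<lambda>(\<alpha>, g). (rng C \<alpha>, \<one>\<^bsub>G\<^esub>)),
     src = (\<lambda>(\<alpha>, g). (act (inv\<^bsub>G\<^esub> g) (src C \<alpha>), \<one>\<^bsub>G\<^esub>)),
     cmp = (\<lambda>(\<alpha>, g) (\<beta>, h). (cmp C \<alpha> (act g \<beta>), \<phi> g \<beta> \<otimes>\<^bsub>G\<^esub> h))\<rparr>"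

definition system_reps ::
  "'c smallcat \<Rightarrow> 'g monoid \<Rightarrow> ('g \<Rightarrow> 'c \<Rightarrow> 'c) \<Rightarrow> ('g \<Rightarrow> 'c \<Rightarrow> 'g) \<Rightarrow>
   (('c \<Rightarrow> 'b::cstar_algebra) \<times> ('g \<Rightarrow> 'b multiplier)) set" where
  "system_reps C G act \<phi> = {(T, U). T \<in> nondeg_reps C \<and>
     U \<in> hom G unitary_group \<and> U \<in> extensional (carrier G) \<and>
     (\<forall>g\<in>carrier G. \<forall>\<alpha>\<in>Mor C. lmul (U g) (T \<alpha>) = rmul (T (act g \<alpha>)) (U (\<phi> g \<alpha>)))}"

definition system_to_zs ::
  "'c smallcat \<Rightarrow> 'g monoid \<Rightarrow> ('c \<Rightarrow> 'b::cstar_algebra) \<times> ('g \<Rightarrow> 'b multiplier) \<Rightarrow>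
   'c \<times> 'g \<Rightarrow> 'b" where
  "system_to_zs C G = (\<lambda>(T, U). \<lambda>(\<alpha>, g)\<in>Mor C \<times> carrier G. rmul (T \<alpha>) (U g))"

definition zs_to_system ::
  "'c smallcat \<Rightarrow> 'g monoid \<Rightarrow> ('c \<times> 'g \<Rightarrow> 'b::cstar_algebra) \<Rightarrow>
   ('c \<Rightarrow> 'b) \<times> ('g \<Rightarrow> 'b multiplier)" where
  "zs_to_system C G R =
    (\<lambda>\<alpha>\<in>Mor C. R (\<alpha>, \<one>\<^bsub>G\<^esub>), \<lambda>g\<in>carrier G. strict_sum (\<lambda>v. embM (R (v, g))) (Obj C))"

end

theory Submission
  imports Defs
begin

text \<open>
  Both assignments are forced by the equation \<open>R\<^bsub>(\<alpha>,g)\<^esub> = T\<^sub>\<alpha> U\<^sub>g\<close>, because a morphism of the product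
  factors as \<open>(\<alpha>, g) = (\<alpha>, 1) (s(\<alpha>), g)\<close> and because \<open>U\<^sub>g = (\<Sum>\<^sub>v T\<^sub>v) U\<^sub>g\<close> is determined by the elements
  \<open>T\<^sub>v U\<^sub>g = R\<^bsub>(v,g)\<^esub>\<close>.

  From \<open>(T, U)\<close> to \<open>R\<close>, the relation \<open>U\<^sub>g T\<^sub>\<alpha> = T\<^bsub>g\<alpha>\<^esub> U\<^bsub>\<phi>(g,\<alpha>)\<^esub>\<close> moves every unitary to the right of every
  partial isometry, and what remains is the composition law of the product. Alignment transfers
  because the right ideal of \<open>(\<alpha>, g)\<close> is \<open>\<alpha>C \<times> G\<close>: the group component is freely adjustable. Hence
  minimal common extensions in the product are those of \<open>C\<close> with arbitrary group elements attached
  (\<open>is_vee_zappa_szep_fst\<close>, \<open>is_vee_zappa_szep_one\<close>), and those elements disappear from the range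
  projections since \<open>T\<^sub>\<alpha> U\<^sub>g (T\<^sub>\<alpha> U\<^sub>g)\<^sup>\<star> = T\<^sub>\<alpha> T\<^sub>\<alpha>\<^sup>\<star>\<close>.

  From \<open>R\<close> to \<open>(T, U)\<close>, the analytic point is the strict convergence of \<open>\<Sum>\<^sub>v R\<^bsub>(v,g)\<^esub>\<close>. Distinct vertices
  have disjoint right ideals, so the join relation makes their projections orthogonal
  (\<open>cat_rep_Obj_orthogonal\<close>). Each partial sum \<open>S\<close> over a finite set \<open>F\<close> then satisfies
  \<open>S\<^sup>\<star> S = \<Sum>\<^bsub>v \<in> F\<^esub> R\<^bsub>(g\<^sup>-\<^sup>1v,1)\<^esub>\<close>, whence \<open>S b\<close> has the same norm as the corresponding
  partial sum of the convergent series \<open>\<Sum>\<^sub>w R\<^bsub>(w,1)\<^esub> b\<close>, and the Cauchy criterion carries over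
  (\<open>summable_left\<close>). Orthogonality also leaves only one nonzero term in each product
  \<open>R\<^sub>x U\<^sub>h\<close> or \<open>U\<^sub>g R\<^sub>x\<close> (\<open>rmul_U\<close>, \<open>lmul_U\<close>). All algebraic properties of \<open>U\<close> follow, since a
  multiplier is determined by its products with the vertex projections
  (\<open>multiplier_eqI_nondegenerate\<close>).

  The join is taken in the bidual, so orthogonality presupposes that \<open>B\<close> embeds into its bidual.
  This is the Hahn--Banach theorem, proved below from the minimality of linear functionals among
  sublinear ones.
\<close>

section \<open>Bounded functionals separate points\<close>

text \<open>Homogeneity is required only for \<open>c > 0\<close>; it forces \<open>p 0 = 0\<close>.\<close>

definition sublinear :: "('a::real_vector \<Rightarrow> real) \<Rightarrow> bool" where
  "sublinear p \<longleftrightarrow> (\<forall>x y. p (x + y) \<le> p x + p y) \<and> (\<forall>c>0. \<forall>x. p (c *\<^sub>R x) = c * p x)"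

lemma sublinear_add: "sublinear p \<Longrightarrow> p (x + y) \<le> p x + p y"
  by (simp add: sublinear_def)

lemma sublinear_scale: "sublinear p \<Longrightarrow> c > 0 \<Longrightarrow> p (c *\<^sub>R x) = c * p x"
  by (simp add: sublinear_def)

lemma sublinear_zero:
  assumes "sublinear p"
  shows "p 0 = 0"
  using sublinear_scale[OF assms, of 2 0] by simp

lemma sublinear_ge_neg:
  assumes "sublinear p"
  shows "- p (- x) \<le> p x"
  using sublinear_add[OF assms, of x "- x"] sublinear_zero[OF assms] by simp

lemma sublinearI:
  assumes add: "\<And>x y. p (x + y) \<le> p x + p y"
    and scale: "\<And>c x. c > 0 \<Longrightarrow> p (c *\<^sub>R x) \<le> c * p x"
  shows "sublinear p"
  unfolding sublinear_def
proof (intro conjI allI impI)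
  fix c :: real and x
  assume c: "c > 0"
  have "p x \<le> (1 / c) * p (c *\<^sub>R x)"
    using scale[of "1 / c" "c *\<^sub>R x"] c by simp
  then have "c * p x \<le> p (c *\<^sub>R x)"
    using c by (simp add: field_simps)
  with scale[OF c, of x] show "p (c *\<^sub>R x) = c * p x" by simp
qed (rule add)

text \<open>
  Lowering a sublinear functional in one direction: the infimum of
  \<open>p (x + t y) - t (p y)\<close> over \<open>t \<ge> 0\<close> is the functional \<open>q\<close>. Taking \<open>t = 0\<close> gives \<open>q \<le> p\<close>, and taking
  \<open>t = 1\<close> at \<open>- y\<close> makes \<open>q (- y) + p y\<close> nonpositive, which for linear \<open>p\<close> already holds. So only
  linear functionals can resist the construction.
\<close>

lemma sublinear_lower:
  assumes p: "sublinear p"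
  obtains q where "sublinear q" "q \<le> p" "q (- y) \<le> - p y"
proof -
  define Q where "Q x = (\<lambda>t. p (x + t *\<^sub>R y) - t * p y) ` {0..}" for x
  define q where "q x = Inf (Q x)" for x
  have below: "- p (- x) \<le> p (x + t *\<^sub>R y) - t * p y" if "t \<ge> 0" for x t
  proof (cases "t = 0")
    case False
    then have "t * p y = p (t *\<^sub>R y)"
      using that sublinear_scale[OF p] by simp
    also have "\<dots> \<le> p (x + t *\<^sub>R y) + p (- x)"
      using sublinear_add[OF p, of "x + t *\<^sub>R y" "- x"] by simp
    finally show ?thesis by simp
  qed (use sublinear_ge_neg[OF p] in auto)
  have bdd: "bdd_below (Q x)" for x
    using below by (auto simp: Q_def intro!: bdd_belowI[of _ "- p (- x)"])
  have ne: "Q x \<noteq> {}" for x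
    by (auto simp: Q_def)
  have q_le: "q x \<le> p (x + t *\<^sub>R y) - t * p y" if "t \<ge> 0" for x t
    unfolding q_def using bdd that by (intro cInf_lower) (auto simp: Q_def)
  have le_q: "r \<le> q x" if "\<And>t. t \<ge> 0 \<Longrightarrow> r \<le> p (x + t *\<^sub>R y) - t * p y" for r x
    unfolding q_def using ne that by (intro cInf_greatest) (auto simp: Q_def)
  have add: "q (a + b) \<le> q a + q b" for a b
  proof -
    have "q (a + b) - (p (a + s *\<^sub>R y) - s * p y) \<le> q b" if s: "s \<ge> 0" for s
    proof (rule le_q)
      fix t :: real
      assume t: "t \<ge> 0"
      have "q (a + b) \<le> p (a + b + (s + t) *\<^sub>R y) - (s + t) * p y"
        using s t by (intro q_le) simp
      also have "a + b + (s + t) *\<^sub>R y = (a + s *\<^sub>R y) + (b + t *\<^sub>R y)"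
        by (simp add: algebra_simps)
      also have "p \<dots> \<le> p (a + s *\<^sub>R y) + p (b + t *\<^sub>R y)"
        by (rule sublinear_add[OF p])
      finally show "q (a + b) - (p (a + s *\<^sub>R y) - s * p y) \<le> p (b + t *\<^sub>R y) - t * p y"
        by (simp add: algebra_simps)
    qed
    then have "q (a + b) - q b \<le> q a"
      by (intro le_q) (simp add: algebra_simps)
    then show ?thesis by simp
  qed
  have scale: "q (c *\<^sub>R a) \<le> c * q a" if c: "c > 0" for c a
  proof -
    have "q (c *\<^sub>R a) / c \<le> q a"
    proof (rule le_q)
      fix t :: real
      assume t: "t \<ge> 0"
      have "q (c *\<^sub>R a) \<le> p (c *\<^sub>R a + (c * t) *\<^sub>R y) - (c * t) * p y"
        using c t by (intro q_le) simp
      also have "c *\<^sub>R a + (c * t) *\<^sub>R y = c *\<^sub>R (a + t *\<^sub>R y)"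
        by (simp add: algebra_simps)
      also have "p \<dots> = c * p (a + t *\<^sub>R y)"
        by (rule sublinear_scale[OF p c])
      finally show "q (c *\<^sub>R a) / c \<le> p (a + t *\<^sub>R y) - t * p y"
        using c by (simp add: field_simps)
    qed
    with c show ?thesis by (simp add: field_simps)
  qed
  have "q (- y) \<le> - p y"
    using q_le[of 1 "- y"] sublinear_zero[OF p] by simp
  moreover have "q \<le> p"
    using q_le[of 0] by (simp add: le_fun_def)
  ultimately show thesis
    using that sublinearI[of q, OF add scale] by blast
qed

text \<open>
  Pointwise infima of chains are again sublinear, so Zorn's lemma provides a minimal sublinear
  functional below \<open>p\<close>. It cannot be lowered further in any direction, hence it is odd, and an odd
  sublinear functional is linear.
\<close>

lemma linear_minorant:
  assumes p: "sublinear p"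
  obtains u where "linear u" "u \<le> p"
proof -
  define S where "S = {q. sublinear q \<and> q \<le> p}"
  have po: "partial_order_on S (relation_of (\<ge>) S)"
    by (rule partial_order_on_relation_ofI) auto
  have "\<exists>u\<in>S. \<forall>q\<in>K. q \<ge> u" if K: "K \<in> Chains (relation_of (\<ge>) S)" for K
  proof (cases "K = {}")
    case True
    then show ?thesis using p by (auto simp: S_def)
  next
    case False
    have KS: "q \<in> S" if "q \<in> K" for q
      using K that by (auto simp: Chains_def relation_of_def)
    have total: "q \<le> q' \<or> q' \<le> q" if "q \<in> K" "q' \<in> K" for q q'
      using K that by (auto simp: Chains_def relation_of_def)
    define u where "u x = (INF q\<in>K. q x)" for x
    have bdd: "bdd_below ((\<lambda>q. q x) ` K)" for x
    proof (rule bdd_belowI2)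
      fix q
      assume "q \<in> K"
      then have "sublinear q" "q (- x) \<le> p (- x)"
        using KS by (auto simp: S_def le_fun_def)
      then show "- p (- x) \<le> q x"
        using sublinear_ge_neg[of q x] by linarith
    qed
    have u_le: "u x \<le> q x" if "q \<in> K" for x q
      unfolding u_def by (rule cINF_lower[OF bdd that])
    have le_u: "r \<le> u x" if "\<And>q. q \<in> K \<Longrightarrow> r \<le> q x" for r x
      unfolding u_def by (rule cINF_greatest[OF False that])
    have add: "u (x + y) \<le> u x + u y" for x y
    proof -
      have *: "u (x + y) \<le> q x + q' y" if q: "q \<in> K" "q' \<in> K" for q q'
      proof -
        \<comment> \<open>Subadditivity of the infimum needs a common lower bound inside the chain.\<close>
        obtain k where k: "k \<in> K" "k \<le> q" "k \<le> q'"
          using total[OF q] q by blast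
        have "u (x + y) \<le> k (x + y)" by (rule u_le[OF k(1)])
        also have "\<dots> \<le> k x + k y"
          using KS[OF k(1)] by (intro sublinear_add) (simp add: S_def)
        also have "\<dots> \<le> q x + q' y"
          using k by (intro add_mono) (auto simp: le_fun_def)
        finally show ?thesis .
      qed
      have "u (x + y) - q x \<le> u y" if "q \<in> K" for q
      proof (rule le_u)
        fix q'
        assume "q' \<in> K"
        then show "u (x + y) - q x \<le> q' y"
          using * that by fastforce
      qed
      then have "u (x + y) - u y \<le> u x"
        by (intro le_u) (simp add: algebra_simps)
      then show ?thesis by simp
    qed
    have scale: "u (c *\<^sub>R x) \<le> c * u x" if c: "c > 0" for c x
    proof -
      have "u (c *\<^sub>R x) / c \<le> u x"
      proof (rule le_u)
        fix q
        assume q: "q \<in> K"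
        then have "q (c *\<^sub>R x) = c * q x"
          using KS c by (intro sublinear_scale) (auto simp: S_def)
        then show "u (c *\<^sub>R x) / c \<le> q x"
          using u_le[OF q, of "c *\<^sub>R x"] c by (simp add: field_simps)
      qed
      with c show ?thesis by (simp add: field_simps)
    qed
    obtain k where k: "k \<in> K" using False by blast
    have "u \<le> k" using u_le[OF k] by (simp add: le_fun_def)
    also have "k \<le> p" using KS[OF k] by (simp add: S_def)
    finally have "u \<le> p" .
    then have "u \<in> S"
      using sublinearI[of u, OF add scale] by (simp add: S_def)
    with u_le show ?thesis by (auto simp: le_fun_def)
  qed
  from predicate_Zorn[OF po this] obtain u
    where u: "u \<in> S" and min: "\<And>q. q \<in> S \<Longrightarrow> q \<le> u \<Longrightarrow> q = u" by blast
  have sub: "sublinear u" and "u \<le> p" using u by (auto simp: S_def)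
  have neg: "u (- y) = - u y" for y
  proof -
    \<comment> \<open>Lowering \<open>u\<close> in the direction \<open>y\<close> leaves it unchanged by minimality.\<close>
    obtain q where q: "sublinear q" "q \<le> u" "q (- y) \<le> - u y"
      using sublinear_lower[OF sub] .
    with \<open>u \<le> p\<close> have "q = u" by (intro min) (auto simp: S_def)
    with q sublinear_ge_neg[OF sub, of y] sublinear_ge_neg[OF sub, of "-y"] show ?thesis by simp
  qed
  have "linear u"
  proof (rule linearI)
    fix x y :: 'a and c :: real
    show "u (x + y) = u x + u y"
    proof (rule antisym)
      show "u (x + y) \<le> u x + u y" by (rule sublinear_add[OF sub])
      have "- u (x + y) \<le> - u x + - u y"
        using sublinear_add[OF sub, of "- x" "- y"] neg[of "x + y"] by (simp add: neg)
      then show "u x + u y \<le> u (x + y)" by simp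
    qed
    consider "c > 0" | "c = 0" | "- c > 0" by linarith
    then show "u (c *\<^sub>R x) = c *\<^sub>R u x"
    proof cases
      case 3
      then show ?thesis using sublinear_scale[OF sub 3, of x] neg[of "c *\<^sub>R x"] by simp
    qed (use sublinear_scale[OF sub] sublinear_zero[OF sub] in auto)
  qed
  then show thesis using \<open>u \<le> p\<close> that by blast
qed

text \<open>
  Lower the norm in the direction \<open>x\<close> before passing to a linear minorant \<open>u\<close>: the value at \<open>- x\<close>
  is then at most \<open>- norm x\<close>, which pins down \<open>u x\<close>.
\<close>

lemma norming_functional:
  fixes x :: "'a::real_normed_vector"
  obtains u where "bounded_linear u" "u x = norm x"
proof -
  have "sublinear (norm :: 'a \<Rightarrow> real)"
    by (rule sublinearI) (simp_all add: norm_triangle_ineq)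
  from sublinear_lower[OF this, of x] obtain q
    where q: "sublinear q" "q \<le> norm" "q (- x) \<le> - norm x" .
  obtain u where u: "linear u" "u \<le> q" using linear_minorant[OF q(1)] .
  have le: "u y \<le> norm y" for y
    using u(2) q(2) by (meson le_fun_def order_trans)
  have neg: "u (- y) = - u y" for y
    by (rule linear_neg[OF u(1)])
  have "bounded_linear u"
  proof (rule bounded_linear_intro[where K = 1])
    fix y
    show "norm (u y) \<le> norm y * 1"
      using le[of y] le[of "- y"] by (simp add: neg abs_le_iff)
  qed (use u(1) in \<open>simp_all add: linear_add linear_scale\<close>)
  moreover have "u x = norm x"
  proof (rule antisym)
    have "u (- x) \<le> - norm x" using u(2) q(3) by (meson le_fun_def order_trans)
    then show "norm x \<le> u x" by (simp add: neg)
  qed (rule le)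
  ultimately show thesis by (rule that)
qed

text \<open>
  A real functional \<open>u\<close> is the real part of the complex linear functional \<open>y \<mapsto> u y - i u (i y)\<close>.
\<close>

lemma dual_separates_points:
  fixes x :: "'b::cstar_algebra"
  assumes "\<And>f. f \<in> dual \<Longrightarrow> f x = 0"
  shows "x = 0"
proof -
  obtain u where u: "bounded_linear u" "u x = norm x"
    using norming_functional .
  interpret u: bounded_linear u by fact
  define f where "f y = Complex (u y) (- u (\<i> *\<^sub>C y))" for y
  have i: "bounded_linear ((*\<^sub>C) \<i> :: 'b \<Rightarrow> 'b)"
  proof (rule bounded_linear_intro[where K = 1])
    fix r y
    show "\<i> *\<^sub>C (r *\<^sub>R y) = r *\<^sub>R (\<i> *\<^sub>C y :: 'b)"
      by (simp add: scaleR_scaleC scaleC_scaleC mult.commute)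
  qed (simp_all add: scaleC_add_right norm_scaleC)
  have f_eq: "f y = of_real (u y) - \<i> * of_real (u (\<i> *\<^sub>C y))" for y
    by (simp add: f_def complex_eq_iff)
  have "bounded_linear f"
    unfolding f_eq[abs_def]
    by (intro bounded_linear_sub bounded_linear_const_mult bounded_linear_compose[OF bounded_linear_of_real]
        u(1) bounded_linear_compose[OF u(1) i])
  moreover have "f (c *\<^sub>C y) = c * f y" for c y
  proof -
    have dec: "c *\<^sub>C y = Re c *\<^sub>R y + Im c *\<^sub>R (\<i> *\<^sub>C y)" for c and y :: 'b
    proof -
      have "c = of_real (Re c) + of_real (Im c) * \<i>"
        by (simp add: complex_eq_iff)
      then have "c *\<^sub>C y = (of_real (Re c) + of_real (Im c) * \<i>) *\<^sub>C y" by simp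
      then show ?thesis by (simp only: scaleR_scaleC scaleC_scaleC scaleC_add_left)
    qed
    have "u (c *\<^sub>C y) = Re c * u y + Im c * u (\<i> *\<^sub>C y)"
      by (subst dec) (simp add: u.add u.scaleR)
    moreover have "u (\<i> *\<^sub>C c *\<^sub>C y) = Re c * u (\<i> *\<^sub>C y) - Im c * u y"
      unfolding scaleC_scaleC by (subst dec) (simp add: u.add u.diff u.scaleR)
    ultimately show ?thesis
      by (simp add: f_def complex_eq_iff)
  qed
  ultimately have "f \<in> dual" by (simp add: dual_def)
  from assms[OF this] have "u x = 0" by (simp add: f_def complex_eq_iff)
  with u(2) show "x = 0" by simp
qed

section \<open>Orthogonality of vertex projections\<close>

lemma cat_repD:
  assumes "cat_rep C T"
  shows "T \<in> extensional (Mor C)"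
    and "\<alpha> \<in> Mor C \<Longrightarrow> (T \<alpha>)\<^sup>\<star> * T \<alpha> = T (src C \<alpha>)"
    and "\<alpha> \<in> Mor C \<Longrightarrow> \<beta> \<in> Mor C \<Longrightarrow> src C \<alpha> = rng C \<beta> \<Longrightarrow> T \<alpha> * T \<beta> = T (cmp C \<alpha> \<beta>)"
    and "\<alpha> \<in> Mor C \<Longrightarrow> \<beta> \<in> Mor C \<Longrightarrow> is_vee C \<alpha> \<beta> F \<Longrightarrow>
      is_bidual_join ((\<lambda>\<gamma>. bidual_emb (T \<gamma> * (T \<gamma>)\<^sup>\<star>)) ` F)
        (bidual_emb (T \<alpha> * (T \<alpha>)\<^sup>\<star> * T \<beta> * (T \<beta>)\<^sup>\<star>))"
  using assms by (simp_all add: cat_rep_def)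

text \<open>
  The empty join is the least projection of the bidual and therefore lies below \<open>0\<close>. Since
  functionals separate points, an element of \<open>B\<close> that vanishes in the bidual vanishes in \<open>B\<close>.
\<close>

lemma bidual_emb_eq_zero_if_empty_join:
  assumes "is_bidual_join {} (bidual_emb x)"
  shows "x = 0"
proof (rule dual_separates_points)
  fix f :: "'a \<Rightarrow> complex"
  assume f: "f \<in> dual"
  have z: "bidual_emb (0::'a) \<in> bidual_proj"
    by (simp add: bidual_proj_def bidual_emb_bidual arens_emb bidual_star_emb star_zero)
  with assms have "bidual_proj_le (bidual_emb x) (bidual_emb 0)"
    by (simp add: is_bidual_join_def)
  then have "bidual_emb (0::'a) = bidual_emb x"
    by (simp add: bidual_proj_le_def arens_emb)
  from fun_cong[OF this, of f] f show "f x = 0"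
    by (simp add: bidual_emb_def dual_def linear_simps)
qed

lemma (in small_category) cat_rep_Obj_projection:
  assumes T: "cat_rep C T" and v: "v \<in> Obj C"
  shows "(T v)\<^sup>\<star> = T v" "T v * T v = T v"
proof -
  have "(T v)\<^sup>\<star> * T v = T v"
    using cat_repD(2)[OF T, of v] v Obj_Mor src_Obj[OF v] by auto
  then show "(T v)\<^sup>\<star> = T v" "T v * T v = T v"
    by (metis star_mult star_star)+
qed

text \<open>
  Elements of \<open>vC\<close> have range \<open>v\<close>, so \<open>vC \<inter> wC\<close> is empty and the empty set is an admissible choice
  of \<open>v \<or> w\<close>.
\<close>

lemma (in small_category) cat_rep_Obj_orthogonal:
  assumes T: "cat_rep C T" and v: "v \<in> Obj C" and w: "w \<in> Obj C" and "v \<noteq> w"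
  shows "T v * T w = 0"
proof -
  have m: "v \<in> Mor C" "w \<in> Mor C" using v w Obj_Mor by auto
  have "rng C \<gamma> = u" if "u \<in> Obj C" "\<gamma> \<in> right_ideal C u" for u \<gamma>
  proof -
    from that(2) obtain \<beta> where "\<gamma> = cmp C u \<beta>" "\<beta> \<in> Mor C" "src C u = rng C \<beta>"
      unfolding right_ideal_def by fastforce
    with that(1) Obj_Mor show ?thesis
      using rng_cmp[of u \<beta>] rng_Obj[of u] by auto
  qed
  then have "right_ideal C v \<inter> right_ideal C w = {}"
    using v w \<open>v \<noteq> w\<close> by (metis disjoint_iff)
  then have "is_vee C v w {}"
    by (simp add: is_vee_def independent_mor_def)
  then have "is_bidual_join ((\<lambda>\<gamma>. bidual_emb (T \<gamma> * (T \<gamma>)\<^sup>\<star>)) ` {})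
      (bidual_emb (T v * (T v)\<^sup>\<star> * T w * (T w)\<^sup>\<star>))"
    using cat_repD(4)[OF T m] by blast
  then have "is_bidual_join {} (bidual_emb (T v * (T v)\<^sup>\<star> * T w * (T w)\<^sup>\<star>))" by simp
  then have "T v * (T v)\<^sup>\<star> * T w * (T w)\<^sup>\<star> = 0"
    by (rule bidual_emb_eq_zero_if_empty_join)
  then show ?thesis
    using cat_rep_Obj_projection[OF T v] cat_rep_Obj_projection[OF T w] by (simp add: mult.assoc)
qed

section \<open>Multipliers and strict sums\<close>

lemma lmul_mult: "lmul m (a * b) = lmul m a * b"
  by (rule cstar_eqI_left) (simp add: mult_lmul flip: mult.assoc)

lemma rmul_mult: "rmul (a * b) m = a * rmul b m"
  by (rule cstar_eqI_right) (simp add: mult.assoc flip: mult_lmul)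

lemma star_rmul: "(rmul a m)\<^sup>\<star> = lmul (m\<^sup>\<star>) (a\<^sup>\<star>)"
  by (simp add: lmul_simps star_star)

lemma ex_multiplier:
  fixes L R :: "'b::cstar_algebra \<Rightarrow> 'b"
  assumes "\<And>a b. a * L b = R a * b"
  obtains m where "\<And>b. lmul m b = L b" "\<And>b. rmul b m = R b"
proof -
  have "\<exists>m. (\<forall>b. lmul m b = L b) \<and> (\<forall>b. rmul b m = R b)"
    using assms by transfer auto
  then show thesis using that by blast
qed

lemma strict_has_sum_iff:
  "strict_has_sum f m A \<longleftrightarrow>
    (\<forall>b. ((\<lambda>i. lmul (f i) b) has_sum lmul m b) A \<and> ((\<lambda>i. rmul b (f i)) has_sum rmul b m) A)"
proof -
  have "lmul (sum f F) b = (\<Sum>i\<in>F. lmul (f i) b)" "rmul b (sum f F) = (\<Sum>i\<in>F. rmul b (f i))" for F b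
    by (induction F rule: infinite_finite_induct) (simp_all add: lmul_simps rmul_simps)
  then show ?thesis
    by (simp add: strict_has_sum_def strict_tendsto_def has_sum_def)
qed

lemma nondegenerate_iff:
  "nondegenerate C T \<longleftrightarrow>
    (\<forall>b. ((\<lambda>v. T v * b) has_sum b) (Obj C) \<and> ((\<lambda>v. b * T v) has_sum b) (Obj C))"
  by (simp add: nondegenerate_def strict_has_sum_iff lmul_embM rmul_embM lmul_simps rmul_simps)

text \<open>
  Expanding \<open>m b = \<Sum>\<^sub>v T\<^sub>v (m b) = \<Sum>\<^sub>v (T\<^sub>v m) b\<close> recovers \<open>m\<close> from the elements \<open>T\<^sub>v m\<close>. Expanding
  \<open>m b\<close> instead of \<open>b\<close> avoids pulling \<open>m\<close> out of an infinite sum.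
\<close>

lemma multiplier_eqI_nondegenerate:
  fixes m n :: "'b::cstar_algebra multiplier"
  assumes T: "nondegenerate C T" and eq: "\<And>v. v \<in> Obj C \<Longrightarrow> rmul (T v) m = rmul (T v) n"
  shows "m = n"
proof -
  have l: "lmul m b = lmul n b" for b
  proof -
    have "((\<lambda>v. T v * lmul m b) has_sum lmul m b) (Obj C)" "((\<lambda>v. T v * lmul n b) has_sum lmul n b) (Obj C)"
      using T by (auto simp: nondegenerate_iff)
    moreover have "T v * lmul m b = T v * lmul n b" if "v \<in> Obj C" for v
      by (simp add: mult_lmul eq[OF that])
    ultimately show ?thesis
      by (metis (no_types, lifting) has_sum_cong has_sum_unique)
  qed
  moreover have "rmul b m = rmul b n" for b
    by (rule cstar_eqI_right) (simp add: l flip: mult_lmul)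
  ultimately show ?thesis by (rule multiplier_eqI)
qed

lemma has_sum_single:
  assumes "w \<in> A" "\<And>v. v \<in> A \<Longrightarrow> v \<noteq> w \<Longrightarrow> f v = 0"
  shows "(f has_sum f w) A"
  using assms has_sum_cong_neutral[of A "{w}" f f "f w"] has_sum_finite[of "{w}" f] by auto

text \<open>
  The difference of two partial sums over \<open>E\<close> and \<open>F\<close> is the difference of the partial sums over
  \<open>E - F\<close> and \<open>F - E\<close>, to which the comparison applies.
\<close>

lemma summable_on_dominated_partial_sums:
  fixes f :: "'i \<Rightarrow> 'b::banach" and g :: "'i \<Rightarrow> 'c::real_normed_vector"
  assumes g: "g summable_on A"
    and le: "\<And>F. finite F \<Longrightarrow> F \<subseteq> A \<Longrightarrow> norm (sum f F) \<le> norm (sum g F)"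
  shows "f summable_on A"
proof -
  obtain s where s: "(sum g \<longlongrightarrow> s) (finite_subsets_at_top A)"
    using g by (auto simp: summable_on_def has_sum_def)
  have "\<exists>P. eventually P (finite_subsets_at_top A) \<and>
      (\<forall>E F. P E \<and> P F \<longrightarrow> dist (sum f E) (sum f F) < e)" if "e > 0" for e
  proof -
    have "eventually (\<lambda>F. dist (sum g F) s < e / 4) (finite_subsets_at_top A)"
      using s \<open>e > 0\<close> by (intro tendstoD) auto
    then obtain X where X: "finite X" "X \<subseteq> A"
      "\<And>F. finite F \<Longrightarrow> X \<subseteq> F \<Longrightarrow> F \<subseteq> A \<Longrightarrow> dist (sum g F) s < e / 4"
      by (auto simp: eventually_finite_subsets_at_top)
    have tail: "norm (sum f (E - F)) < e / 2"
      if "finite E" "X \<subseteq> E" "E \<subseteq> A" "finite F" "X \<subseteq> F" "F \<subseteq> A" for E F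
    proof -
      have "sum g (E - F) = sum g E - sum g (E \<inter> F)"
        using that(1) sum.Int_Diff[of E g F] by simp
      then have "norm (sum g (E - F)) \<le> dist (sum g E) s + dist (sum g (E \<inter> F)) s"
        using dist_triangle2[of "sum g E" "sum g (E \<inter> F)" s] by (simp add: dist_norm)
      also have "\<dots> < e / 4 + e / 4"
        using that by (intro add_strict_mono X(3)) auto
      finally show ?thesis
        using le[of "E - F"] that by fastforce
    qed
    have "dist (sum f E) (sum f F) < e"
      if "finite E" "X \<subseteq> E" "E \<subseteq> A" "finite F" "X \<subseteq> F" "F \<subseteq> A" for E F
    proof -
      have "sum f E - sum f F = sum f (E - F) - sum f (F - E)"
        using that sum.Int_Diff[of E f F] sum.Int_Diff[of F f E] by (simp add: Int_commute)
      then have "dist (sum f E) (sum f F) \<le> norm (sum f (E - F)) + norm (sum f (F - E))"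
        by (simp add: dist_norm norm_triangle_ineq4)
      also have "\<dots> < e / 2 + e / 2"
        using that by (intro add_strict_mono tail)
      finally show ?thesis by simp
    qed
    then show ?thesis
      using X(1,2) by (intro exI[of _ "\<lambda>F. finite F \<and> X \<subseteq> F \<and> F \<subseteq> A"])
        (auto simp: eventually_finite_subsets_at_top)
  qed
  then have "cauchy_filter (filtermap (sum f) (finite_subsets_at_top A))"
    by (simp add: cauchy_filter_metric_filtermap)
  moreover have "complete (UNIV :: 'b set)"
    by (meson Cauchy_convergent UNIV_I complete_def convergent_def)
  ultimately obtain L where "(sum f \<longlongrightarrow> L) (finite_subsets_at_top A)"
    using complete_uniform[where S = UNIV] by (force simp: filterlim_def)
  then show ?thesis
    by (auto simp: summable_on_def has_sum_def)
qed

lemma star_sum: "(sum f F)\<^sup>\<star> = (\<Sum>i\<in>F. (f i :: 'b::cstar_algebra)\<^sup>\<star>)"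
  by (induction F rule: infinite_finite_induct) (simp_all add: star_zero star_add)

lemma star_sum_mult_sum_orthogonal:
  fixes x :: "'i \<Rightarrow> 'b::cstar_algebra"
  assumes "finite F" "\<And>v w. v \<in> F \<Longrightarrow> w \<in> F \<Longrightarrow> v \<noteq> w \<Longrightarrow> (x v)\<^sup>\<star> * x w = 0"
  shows "(sum x F)\<^sup>\<star> * sum x F = (\<Sum>v\<in>F. (x v)\<^sup>\<star> * x v)"
proof -
  have "(sum x F)\<^sup>\<star> * sum x F = (\<Sum>v\<in>F. \<Sum>w\<in>F. (x v)\<^sup>\<star> * x w)"
    by (simp add: star_sum sum_product)
  also have "\<dots> = (\<Sum>v\<in>F. \<Sum>w\<in>F. if v = w then (x v)\<^sup>\<star> * x v else 0)"
    using assms(2) by (intro sum.cong refl) auto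
  also have "\<dots> = (\<Sum>v\<in>F. (x v)\<^sup>\<star> * x v)"
    using assms(1) by simp
  finally show ?thesis .
qed

text \<open>
  By the C*-identity, \<open>norm (x * b)\<close> depends on \<open>x\<close> only through \<open>x\<^sup>\<star> * x\<close>. This is how norms of
  partial sums of partial isometries are compared with those of their source projections.
\<close>

lemma norm_mult_eq_if_star_mult_eq:
  fixes x p b :: "'b::cstar_algebra"
  assumes "x\<^sup>\<star> * x = p\<^sup>\<star> * p"
  shows "norm (x * b) = norm (p * b)"
proof -
  have "(x * b)\<^sup>\<star> * (x * b) = b\<^sup>\<star> * (x\<^sup>\<star> * x) * b" "(p * b)\<^sup>\<star> * (p * b) = b\<^sup>\<star> * (p\<^sup>\<star> * p) * b"
    by (simp_all add: star_mult mult.assoc)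
  then have "(norm (x * b))\<^sup>2 = (norm (p * b))\<^sup>2"
    using assms by (simp flip: cstar_identity)
  then show ?thesis by simp
qed

section \<open>Right ideals in the Zappa--Szep product\<close>

sublocale category_system \<subseteq> group G
  using group_hom by (simp add: group_hom_def)

context category_system
begin

abbreviation "D \<equiv> zappa_szep C G act \<phi>"

lemma Obj_in_Mor: "v \<in> Obj C \<Longrightarrow> v \<in> Mor C"
  using Obj_Mor by blast

lemma act_Mor: "g \<in> carrier G \<Longrightarrow> \<alpha> \<in> Mor C \<Longrightarrow> act g \<alpha> \<in> Mor C"
  by (rule element_image) auto

lemma act_Obj: "g \<in> carrier G \<Longrightarrow> v \<in> Obj C \<Longrightarrow> act g v \<in> Obj C"
  by (metis Obj_in_Mor act_Mor rng_act rng_closed rng_Obj)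

lemma act_one: "\<alpha> \<in> Mor C \<Longrightarrow> act \<one> \<alpha> = \<alpha>"
  by (metis id_eq_one restrict_apply')

lemma act_inv_act: "g \<in> carrier G \<Longrightarrow> \<alpha> \<in> Mor C \<Longrightarrow> act (inv g) (act g \<alpha>) = \<alpha>"
  by (rule orbit_sym_aux) auto

lemma act_act_inv: "g \<in> carrier G \<Longrightarrow> \<alpha> \<in> Mor C \<Longrightarrow> act g (act (inv g) \<alpha>) = \<alpha>"
  using act_inv_act[of "inv g"] by simp

lemma bij_betw_act_Obj: "g \<in> carrier G \<Longrightarrow> bij_betw (act g) (Obj C) (Obj C)"
  by (rule bij_betwI[where g = "act (inv g)"])
    (auto simp: act_Obj act_inv_act act_act_inv Obj_in_Mor)

lemma cocycle_one:
  assumes "\<alpha> \<in> Mor C"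
  shows "\<phi> \<one> \<alpha> = \<one>"
proof -
  \<comment> \<open>An idempotent of a group is its unit.\<close>
  have "\<phi> \<one> \<alpha> = \<phi> \<one> \<alpha> \<otimes> \<phi> \<one> \<alpha>"
    using cocycle_mult[of \<one> \<one> \<alpha>] assms by (simp add: act_one)
  then show ?thesis
    using assms by (metis cocycle_closed l_cancel_one one_closed)
qed

lemma zappa_szep_simps:
  "Mor D = Mor C \<times> carrier G" "Obj D = Obj C \<times> {\<one>}"
  "rng D (\<alpha>, g) = (rng C \<alpha>, \<one>)" "src D (\<alpha>, g) = (act (inv g) (src C \<alpha>), \<one>)"
  "cmp D (\<alpha>, g) (\<beta>, h) = (cmp C \<alpha> (act g \<beta>), \<phi> g \<beta> \<otimes> h)"
  by (simp_all add: zappa_szep_def)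

lemma composable_iff:
  assumes "\<alpha> \<in> Mor C" "\<beta> \<in> Mor C" "g \<in> carrier G"
  shows "act (inv g) (src C \<alpha>) = rng C \<beta> \<longleftrightarrow> src C \<alpha> = rng C (act g \<beta>)"
  using assms act_inv_act[of g "rng C \<beta>"] act_act_inv[of g "src C \<alpha>"] rng_closed src_closed Obj_in_Mor
  by (auto simp: rng_act)

text \<open>
  An element of \<open>(\<alpha>, g)D\<close> is \<open>(\<alpha>(g\<beta>), \<phi>(g, \<beta>)h)\<close>, where \<open>g\<beta>\<close> runs through all morphisms
  composable with \<open>\<alpha>\<close> and, for fixed \<open>\<beta>\<close>, the second component runs through all of \<open>G\<close>.
\<close>

lemma right_ideal_zappa_szep:
  assumes a: "\<alpha> \<in> Mor C" "g \<in> carrier G"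
  shows "right_ideal D (\<alpha>, g) = right_ideal C \<alpha> \<times> carrier G"
proof (intro subset_antisym subsetI; clarify)
  fix \<gamma> k
  assume "(\<gamma>, k) \<in> right_ideal D (\<alpha>, g)"
  then show "\<gamma> \<in> right_ideal C \<alpha> \<and> k \<in> carrier G"
    using a composable_iff[OF a(1) _ a(2)]
    by (force simp: right_ideal_def zappa_szep_simps cocycle_closed act_Mor)
next
  fix \<gamma> k
  assume "\<gamma> \<in> right_ideal C \<alpha>" and k: "k \<in> carrier G"
  then obtain \<beta> where b: "\<beta> \<in> Mor C" "rng C \<beta> = src C \<alpha>" "\<gamma> = cmp C \<alpha> \<beta>"
    by (auto simp: right_ideal_def)
  \<comment> \<open>Solve \<open>g\<beta>' = \<beta>\<close> for the first component and \<open>\<phi>(g, \<beta>')h = k\<close> for the second.\<close>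
  define \<beta>' where "\<beta>' = act (inv g) \<beta>"
  have b': "\<beta>' \<in> Mor C" "act g \<beta>' = \<beta>"
    using a b by (simp_all add: \<beta>'_def act_Mor act_act_inv)
  define h where "h = inv (\<phi> g \<beta>') \<otimes> k"
  have p: "\<phi> g \<beta>' \<in> carrier G" using a b' by (simp add: cocycle_closed)
  then have h: "h \<in> carrier G" "\<phi> g \<beta>' \<otimes> h = k"
    using k by (simp_all add: h_def flip: m_assoc)
  have "(\<gamma>, k) = cmp D (\<alpha>, g) (\<beta>', h)" "(\<beta>', h) \<in> Mor D" "rng D (\<beta>', h) = src D (\<alpha>, g)"
    using b b' h composable_iff[OF a(1) b'(1) a(2)] by (simp_all add: zappa_szep_simps)
  then show "(\<gamma>, k) \<in> right_ideal D (\<alpha>, g)"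
    unfolding right_ideal_def by blast
qed

text \<open>
  Elements of \<open>F\<close> with equal first component generate the same right ideal; independence of \<open>F\<close>
  passes to \<open>fst ` F\<close> because distinct first components come from distinct elements of \<open>F\<close>.
\<close>

lemma is_vee_zappa_szep_fst:
  assumes a: "\<alpha> \<in> Mor C" "g \<in> carrier G" "\<beta> \<in> Mor C" "h \<in> carrier G"
    and F: "is_vee D (\<alpha>, g) (\<beta>, h) F"
  shows "is_vee C \<alpha> \<beta> (fst ` F)"
proof -
  have fin: "finite F" and sub: "F \<subseteq> Mor C \<times> carrier G" and ind: "independent_mor D F"
    and un: "right_ideal D (\<alpha>, g) \<inter> right_ideal D (\<beta>, h) = (\<Union>x\<in>F. right_ideal D x)"
    using F by (simp_all add: is_vee_def zappa_szep_simps)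
  have ri: "right_ideal D x = right_ideal C (fst x) \<times> carrier G" if "x \<in> F" for x
    using that sub right_ideal_zappa_szep[of "fst x" "snd x"] by auto
  have "independent_mor C (fst ` F)"
    unfolding independent_mor_def
  proof (intro ballI impI)
    fix \<gamma> \<gamma>'
    assume "\<gamma> \<in> fst ` F" "\<gamma>' \<in> fst ` F" and ne: "\<gamma> \<noteq> \<gamma>'"
    then obtain x y where x: "x \<in> F" "\<gamma> = fst x" and y: "y \<in> F" "\<gamma>' = fst y" by blast
    with ne ind have "x \<notin> right_ideal D y" by (auto simp: independent_mor_def)
    then show "\<gamma> \<notin> right_ideal C \<gamma>'"
      using ri[OF y(1)] x y sub by (auto simp: mem_Times_iff)
  qed
  moreover have "(\<Union>x\<in>F. right_ideal D x) = (\<Union>x\<in>F. right_ideal C (fst x) \<times> carrier G)"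
    by (rule SUP_cong[OF refl ri])
  then have "(right_ideal C \<alpha> \<inter> right_ideal C \<beta>) \<times> carrier G
      = (\<Union>\<gamma>\<in>fst ` F. right_ideal C \<gamma>) \<times> carrier G"
    using un a by (simp add: right_ideal_zappa_szep) blast
  then have "right_ideal C \<alpha> \<inter> right_ideal C \<beta> = (\<Union>\<gamma>\<in>fst ` F. right_ideal C \<gamma>)"
    using one_closed by blast
  ultimately show ?thesis
    using fin sub by (auto simp: is_vee_def)
qed

lemma is_vee_zappa_szep_one:
  assumes a: "\<alpha> \<in> Mor C" "\<beta> \<in> Mor C" and F: "is_vee C \<alpha> \<beta> F"
  shows "is_vee D (\<alpha>, \<one>) (\<beta>, \<one>) (F \<times> {\<one>})"
proof -
  have sub: "F \<subseteq> Mor C" using F by (simp add: is_vee_def)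
  then have ri: "right_ideal D (\<gamma>, \<one>) = right_ideal C \<gamma> \<times> carrier G" if "\<gamma> \<in> F" for \<gamma>
    using that by (intro right_ideal_zappa_szep) auto
  have "(\<Union>x\<in>F \<times> {\<one>}. right_ideal D x) = (\<Union>\<gamma>\<in>F. right_ideal C \<gamma>) \<times> carrier G"
    using ri by auto
  moreover have "independent_mor D (F \<times> {\<one>})"
    using F ri by (auto simp: is_vee_def independent_mor_def)
  ultimately show ?thesis
    using F a by (auto simp: is_vee_def zappa_szep_simps right_ideal_zappa_szep)
qed

lemma nondegenerate_zappa_szep:
  "nondegenerate D R \<longleftrightarrow> nondegenerate C (\<lambda>v. R (v, \<one>))"
proof -
  have "bij_betw (\<lambda>v. (v, \<one>)) (Obj C) (Obj D)"
    by (auto simp: bij_betw_def inj_on_def zappa_szep_simps)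
  then show ?thesis
    by (simp add: nondegenerate_iff has_sum_reindex_bij_betw
        flip: has_sum_reindex_bij_betw[of "\<lambda>v. (v, \<one>)" "Obj C" "Obj D"])
qed

section \<open>From the system to the product\<close>

lemma system_repD:
  assumes "(T, U) \<in> system_reps C G act \<phi>"
  shows "cat_rep C T" "nondegenerate C T" "U \<in> extensional (carrier G)"
    and "g \<in> carrier G \<Longrightarrow> (U g)\<^sup>\<star> * U g = 1" "g \<in> carrier G \<Longrightarrow> U g * (U g)\<^sup>\<star> = 1"
    and "g \<in> carrier G \<Longrightarrow> h \<in> carrier G \<Longrightarrow> U g * U h = U (g \<otimes> h)"
    and "g \<in> carrier G \<Longrightarrow> \<alpha> \<in> Mor C \<Longrightarrow> lmul (U g) (T \<alpha>) = rmul (T (act g \<alpha>)) (U (\<phi> g \<alpha>))"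
  using assms
  by (auto simp: system_reps_def nondeg_reps_def hom_def unitary_group_def Pi_def)

lemma system_rep_unitary:
  assumes TU: "(T, U) \<in> system_reps C G act \<phi>"
  shows "U \<one> = 1" "g \<in> carrier G \<Longrightarrow> (U g)\<^sup>\<star> = U (inv g)"
proof -
  note u = system_repD(4,5,6)[OF TU]
  have "U \<one> = ((U \<one>)\<^sup>\<star> * U \<one>) * U \<one>" using u(1)[of \<one>] by simp
  also have "\<dots> = (U \<one>)\<^sup>\<star> * U \<one>" unfolding mult.assoc using u(3)[of \<one> \<one>] by simp
  also have "\<dots> = 1" using u(1)[of \<one>] by simp
  finally show one: "U \<one> = 1" .
  assume g: "g \<in> carrier G"
  have "(U g)\<^sup>\<star> = (U (inv g) * U g) * (U g)\<^sup>\<star>" using g one u(3)[of "inv g" g] by simp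
  also have "\<dots> = U (inv g)" using g u(2)[of g] by (simp add: mult.assoc)
  finally show "(U g)\<^sup>\<star> = U (inv g)" .
qed

lemma system_to_zs_apply:
  "\<alpha> \<in> Mor C \<Longrightarrow> g \<in> carrier G \<Longrightarrow> system_to_zs C G (T, U) (\<alpha>, g) = rmul (T \<alpha>) (U g)"
  by (simp add: system_to_zs_def)

lemma system_to_zs_in_nondeg_reps:
  assumes TU: "(T, U) \<in> system_reps C G act \<phi>"
  shows "system_to_zs C G (T, U) \<in> nondeg_reps D"
proof -
  note rep = system_repD[OF TU] and unitary = system_rep_unitary[OF TU]
  note T_initial = cat_repD(2)[OF rep(1)] and T_mult = cat_repD(3)[OF rep(1)]
    and T_join = cat_repD(4)[OF rep(1)]
  define R where "R = system_to_zs C G (T, U)"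
  have R: "R (\<alpha>, g) = rmul (T \<alpha>) (U g)" if "\<alpha> \<in> Mor C" "g \<in> carrier G" for \<alpha> g
    unfolding R_def using that by (rule system_to_zs_apply)
  have initial: "(R (\<alpha>, g))\<^sup>\<star> * R (\<alpha>, g) = R (src D (\<alpha>, g))"
    if "\<alpha> \<in> Mor C" "g \<in> carrier G" for \<alpha> g
  proof -
    let ?w = "act (inv g) (src C \<alpha>)"
    have s: "src C \<alpha> \<in> Mor C" "src C \<alpha> \<in> Obj C" using that src_closed Obj_in_Mor by auto
    have "(R (\<alpha>, g))\<^sup>\<star> * R (\<alpha>, g) = rmul (lmul ((U g)\<^sup>\<star>) ((T \<alpha>)\<^sup>\<star> * T \<alpha>)) (U g)"
      using that by (simp add: R star_rmul lmul_mult rmul_mult)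
    also have "\<dots> = rmul (lmul (U (inv g)) (T (src C \<alpha>))) (U g)"
      using that by (simp add: T_initial unitary(2))
    \<comment> \<open>The cocycle is \<open>g\<^sup>-\<^sup>1\<close> at a vertex, so \<open>U\<close> at \<open>g\<^sup>-\<^sup>1\<close> passes \<open>T\<close> unchanged and cancels \<open>U\<^sub>g\<close>.\<close>
    also have "\<dots> = rmul (rmul (T ?w) (U (inv g))) (U g)"
      using that s by (simp add: rep(7) cocycle_Obj)
    also have "\<dots> = rmul (T ?w) (U \<one>)"
      using that by (simp add: rep(6) flip: rmul_simps(4))
    finally show ?thesis
      using that s by (simp add: R zappa_szep_simps act_Mor)
  qed
  have mult: "R (\<alpha>, g) * R (\<beta>, h) = R (cmp D (\<alpha>, g) (\<beta>, h))"
    if "\<alpha> \<in> Mor C" "g \<in> carrier G" "\<beta> \<in> Mor C" "h \<in> carrier G" "src D (\<alpha>, g) = rng D (\<beta>, h)"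
    for \<alpha> g \<beta> h
  proof -
    have s: "src C \<alpha> = rng C (act g \<beta>)"
      using that composable_iff[of \<alpha> \<beta> g] by (simp add: zappa_szep_simps)
    have "R (\<alpha>, g) * R (\<beta>, h) = rmul (T \<alpha> * lmul (U g) (T \<beta>)) (U h)"
      using that by (simp add: R rmul_mult mult_lmul)
    also have "\<dots> = rmul (T \<alpha> * T (act g \<beta>)) (U (\<phi> g \<beta>) * U h)"
      using that by (simp add: rep(7) rmul_mult rmul_simps(4))
    also have "\<dots> = rmul (T (cmp C \<alpha> (act g \<beta>))) (U (\<phi> g \<beta> \<otimes> h))"
      using that s by (simp add: T_mult act_Mor rep(6) cocycle_closed)
    finally show ?thesis
      using that s by (simp add: zappa_szep_simps R cmp_closed act_Mor cocycle_closed)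
  qed
  have final: "R (\<alpha>, g) * (R (\<alpha>, g))\<^sup>\<star> = T \<alpha> * (T \<alpha>)\<^sup>\<star>"
    if "\<alpha> \<in> Mor C" "g \<in> carrier G" for \<alpha> g
    using that rep(5)[of g]
    by (simp add: R star_rmul mult_lmul flip: rmul_simps(4)) (simp add: rmul_simps)
  have join: "is_bidual_join ((\<lambda>x. bidual_emb (R x * (R x)\<^sup>\<star>)) ` F)
      (bidual_emb (R (\<alpha>, g) * (R (\<alpha>, g))\<^sup>\<star> * R (\<beta>, h) * (R (\<beta>, h))\<^sup>\<star>))"
    if m: "\<alpha> \<in> Mor C" "g \<in> carrier G" "\<beta> \<in> Mor C" "h \<in> carrier G" and F: "is_vee D (\<alpha>, g) (\<beta>, h) F"
    for \<alpha> g \<beta> h F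
  proof -
    have "F \<subseteq> Mor C \<times> carrier G" using F by (simp add: is_vee_def zappa_szep_simps)
    then have "(\<lambda>x. bidual_emb (R x * (R x)\<^sup>\<star>)) ` F = (\<lambda>\<gamma>. bidual_emb (T \<gamma> * (T \<gamma>)\<^sup>\<star>)) ` fst ` F"
      unfolding image_image by (intro image_cong refl) (auto simp: final)
    moreover have "R (\<alpha>, g) * (R (\<alpha>, g))\<^sup>\<star> * R (\<beta>, h) * (R (\<beta>, h))\<^sup>\<star> = T \<alpha> * (T \<alpha>)\<^sup>\<star> * T \<beta> * (T \<beta>)\<^sup>\<star>"
      using final[OF m(1,2)] final[OF m(3,4)] by (simp add: mult.assoc)
    ultimately show ?thesis
      using T_join[OF m(1,3) is_vee_zappa_szep_fst[OF m F]] by simp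
  qed
  have "R \<in> extensional (Mor D)"
    by (simp add: R_def system_to_zs_def zappa_szep_simps)
  then have "cat_rep D R"
    using initial mult join unfolding cat_rep_def by (simp add: zappa_szep_simps(1))
  moreover have "nondegenerate C (\<lambda>v. R (v, \<one>)) \<longleftrightarrow> nondegenerate C T"
    unfolding nondegenerate_iff
    by (intro all_cong1 conj_cong has_sum_cong) (simp_all add: R Obj_in_Mor unitary rmul_simps)
  then have "nondegenerate D R"
    using rep(2) by (simp add: nondegenerate_zappa_szep)
  ultimately show ?thesis
    by (simp add: nondeg_reps_def R_def)
qed

text \<open>
  Multiplication by \<open>U\<^sub>g\<close> on the left of \<open>b\<close> is immediate from nondegeneracy applied to \<open>U\<^sub>g b\<close>. On the
  other side, \<open>b T\<^sub>v U\<^sub>g\<close> has the multiplier at the wrong end; rewriting \<open>T\<^bsub>gv\<^esub> U\<^sub>g = U\<^sub>g T\<^sub>v\<close> and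
  reindexing along \<open>v \<mapsto> gv\<close> reduces it to nondegeneracy applied to \<open>b U\<^sub>g\<close>.
\<close>

lemma system_rep_strict_sum:
  assumes TU: "(T, U) \<in> system_reps C G act \<phi>" and g: "g \<in> carrier G"
  shows "strict_has_sum (\<lambda>v. embM (rmul (T v) (U g))) (U g) (Obj C)"
  unfolding strict_has_sum_iff lmul_embM rmul_embM
proof (intro allI conjI)
  fix b
  note rep = system_repD[OF TU]
  have sums: "((\<lambda>v. T v * b) has_sum b) (Obj C)" "((\<lambda>v. b * T v) has_sum b) (Obj C)" for b
    using rep(2) by (simp_all add: nondegenerate_iff)
  show "((\<lambda>v. rmul (T v) (U g) * b) has_sum lmul (U g) b) (Obj C)"
    using sums(1)[of "lmul (U g) b"] by (simp add: mult_lmul)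
  have "b * rmul (T (act g v)) (U g) = rmul b (U g) * T v" if "v \<in> Obj C" for v
    using that g rep(7)[of g v] by (simp add: Obj_in_Mor cocycle_Obj flip: mult_lmul)
  then have "((\<lambda>v. b * rmul (T (act g v)) (U g)) has_sum rmul b (U g)) (Obj C)"
    using sums(2)[of "rmul b (U g)"] by (simp cong: has_sum_cong)
  then show "((\<lambda>v. b * rmul (T v) (U g)) has_sum rmul b (U g)) (Obj C)"
    by (simp add: has_sum_reindex_bij_betw[OF bij_betw_act_Obj[OF g], of "\<lambda>v. b * rmul (T v) (U g)"])
qed

lemma zs_to_system_inverse:
  assumes TU: "(T, U) \<in> system_reps C G act \<phi>"
  shows "zs_to_system C G (system_to_zs C G (T, U)) = (T, U)"
proof -
  let ?R = "system_to_zs C G (T, U)"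
  note rep = system_repD[OF TU]
  have "(\<lambda>\<alpha>\<in>Mor C. ?R (\<alpha>, \<one>)) = T"
    using rep(1) by (intro extensionalityI[of _ "Mor C"])
      (auto simp: cat_rep_def system_to_zs_apply system_rep_unitary(1)[OF TU] rmul_simps)
  moreover have "strict_sum (\<lambda>v. embM (?R (v, g))) (Obj C) = U g" if g: "g \<in> carrier G" for g
  proof (rule strict_sum_eqI)
    have "strict_has_sum (\<lambda>v. embM (?R (v, g))) (U g) (Obj C) \<longleftrightarrow>
        strict_has_sum (\<lambda>v. embM (rmul (T v) (U g))) (U g) (Obj C)"
      unfolding strict_has_sum_iff
      by (intro all_cong1 conj_cong has_sum_cong) (simp_all add: system_to_zs_apply Obj_in_Mor g)
    then show "strict_has_sum (\<lambda>v. embM (?R (v, g))) (U g) (Obj C)"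
      using system_rep_strict_sum[OF TU g] by simp
  qed
  then have "(\<lambda>g\<in>carrier G. strict_sum (\<lambda>v. embM (?R (v, g))) (Obj C)) = U"
    using rep(3) by (intro extensionalityI[of _ "carrier G"]) auto
  ultimately show ?thesis by (simp add: zs_to_system_def)
qed

section \<open>From the product to the system\<close>

lemma cat_rep_restrict_one:
  assumes R: "cat_rep D R"
  shows "cat_rep C (\<lambda>\<alpha>\<in>Mor C. R (\<alpha>, \<one>))"
proof -
  let ?T = "\<lambda>\<alpha>\<in>Mor C. R (\<alpha>, \<one>)"
  have "is_bidual_join ((\<lambda>\<gamma>. bidual_emb (?T \<gamma> * (?T \<gamma>)\<^sup>\<star>)) ` F)
      (bidual_emb (?T \<alpha> * (?T \<alpha>)\<^sup>\<star> * ?T \<beta> * (?T \<beta>)\<^sup>\<star>))"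
    if m: "\<alpha> \<in> Mor C" "\<beta> \<in> Mor C" and F: "is_vee C \<alpha> \<beta> F" for \<alpha> \<beta> F
  proof -
    have "(\<alpha>, \<one>) \<in> Mor D" "(\<beta>, \<one>) \<in> Mor D" using m by (simp_all add: zappa_szep_simps)
    then have "is_bidual_join ((\<lambda>x. bidual_emb (R x * (R x)\<^sup>\<star>)) ` (F \<times> {\<one>}))
        (bidual_emb (R (\<alpha>, \<one>) * (R (\<alpha>, \<one>))\<^sup>\<star> * R (\<beta>, \<one>) * (R (\<beta>, \<one>))\<^sup>\<star>))"
      using cat_repD(4)[OF R] is_vee_zappa_szep_one[OF m F] by blast
    moreover have "(\<lambda>x. bidual_emb (R x * (R x)\<^sup>\<star>)) ` (F \<times> {\<one>}) =
        (\<lambda>\<gamma>. bidual_emb (?T \<gamma> * (?T \<gamma>)\<^sup>\<star>)) ` F"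
      using F by (auto simp: is_vee_def image_iff subset_iff)
    ultimately show ?thesis using m by simp
  qed
  moreover have "(R (\<alpha>, \<one>))\<^sup>\<star> * R (\<alpha>, \<one>) = R (src C \<alpha>, \<one>)" if "\<alpha> \<in> Mor C" for \<alpha>
    using cat_repD(2)[OF R, of "(\<alpha>, \<one>)"] that
    by (simp add: zappa_szep_simps act_one src_closed Obj_in_Mor)
  moreover have "R (\<alpha>, \<one>) * R (\<beta>, \<one>) = R (cmp C \<alpha> \<beta>, \<one>)"
    if "\<alpha> \<in> Mor C" "\<beta> \<in> Mor C" "src C \<alpha> = rng C \<beta>" for \<alpha> \<beta>
    using cat_repD(3)[OF R, of "(\<alpha>, \<one>)" "(\<beta>, \<one>)"] that
    by (simp add: zappa_szep_simps act_one cocycle_one rng_closed Obj_in_Mor)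
  moreover have "?T \<in> extensional (Mor C)" by simp
  ultimately show ?thesis
    unfolding cat_rep_def by (simp add: src_closed Obj_in_Mor cmp_closed)
qed

end

locale zappa_szep_rep = category_system C G act \<phi>
  for C :: "'c smallcat" and G :: "'g monoid" (structure) and act :: "'g \<Rightarrow> 'c \<Rightarrow> 'c"
    and \<phi> :: "'g \<Rightarrow> 'c \<Rightarrow> 'g" +
  fixes R :: "'c \<times> 'g \<Rightarrow> 'b::cstar_algebra"
  assumes cat_rep: "cat_rep D R" and nondegenerate: "nondegenerate D R"
begin

lemma mult:
  assumes "\<alpha> \<in> Mor C" "g \<in> carrier G" "\<beta> \<in> Mor C" "h \<in> carrier G" "act (inv g) (src C \<alpha>) = rng C \<beta>"
  shows "R (\<alpha>, g) * R (\<beta>, h) = R (cmp C \<alpha> (act g \<beta>), \<phi> g \<beta> \<otimes> h)"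
  using cat_repD(3)[OF cat_rep, of "(\<alpha>, g)" "(\<beta>, h)"] assms by (simp add: zappa_szep_simps)

lemma star_mult_self:
  assumes "\<alpha> \<in> Mor C" "g \<in> carrier G"
  shows "(R (\<alpha>, g))\<^sup>\<star> * R (\<alpha>, g) = R (act (inv g) (src C \<alpha>), \<one>)"
  using cat_repD(2)[OF cat_rep, of "(\<alpha>, g)"] assms by (simp add: zappa_szep_simps)

lemma mult_Obj:
  assumes "\<alpha> \<in> Mor C" "g \<in> carrier G" "h \<in> carrier G"
  shows "R (\<alpha>, g) * R (act (inv g) (src C \<alpha>), h) = R (\<alpha>, g \<otimes> h)"
proof -
  have s: "src C \<alpha> \<in> Obj C" "act (inv g) (src C \<alpha>) \<in> Obj C"
    using assms by (simp_all add: src_closed act_Obj)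
  then show ?thesis
    using assms mult[of \<alpha> g "act (inv g) (src C \<alpha>)" h]
    by (simp add: Obj_in_Mor rng_Obj act_act_inv cocycle_Obj cmp_src_id)
qed

lemma Obj_mult:
  assumes "\<alpha> \<in> Mor C" "g \<in> carrier G" "h \<in> carrier G"
  shows "R (act g (rng C \<alpha>), g) * R (\<alpha>, h) = R (act g \<alpha>, \<phi> g \<alpha> \<otimes> h)"
proof -
  have s: "rng C \<alpha> \<in> Obj C" "act g (rng C \<alpha>) \<in> Obj C"
    using assms by (simp_all add: rng_closed act_Obj)
  have "cmp C (act g (rng C \<alpha>)) (act g \<alpha>) = act g \<alpha>"
    using rng_cmp_id[of "act g \<alpha>"] assms by (simp add: act_Mor rng_act)
  then show ?thesis
    using assms s mult[of "act g (rng C \<alpha>)" g \<alpha> h]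
    by (simp add: Obj_in_Mor src_Obj act_inv_act)
qed

text \<open>
  Inserting the vertex projections at the source of \<open>(\<alpha>, g)\<close> and the range of \<open>(\<beta>, h)\<close> puts two
  orthogonal projections in the middle of the product.
\<close>

lemma mult_eq_zero:
  assumes m: "\<alpha> \<in> Mor C" "g \<in> carrier G" "\<beta> \<in> Mor C" "h \<in> carrier G"
    and ne: "act (inv g) (src C \<alpha>) \<noteq> rng C \<beta>"
  shows "R (\<alpha>, g) * R (\<beta>, h) = 0"
proof -
  let ?v = "act (inv g) (src C \<alpha>)" and ?w = "rng C \<beta>"
  have o: "?v \<in> Obj C" "?w \<in> Obj C"
    using m by (simp_all add: src_closed act_Obj rng_closed)
  have "R (\<alpha>, g) * R (?v, \<one>) = R (\<alpha>, g)" using mult_Obj[of \<alpha> g \<one>] m by simp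
  moreover have "R (?w, \<one>) * R (\<beta>, h) = R (\<beta>, h)"
    using Obj_mult[of \<beta> \<one> h] m o by (simp add: act_one Obj_in_Mor cocycle_one)
  ultimately have "R (\<alpha>, g) * R (\<beta>, h) = (R (\<alpha>, g) * R (?v, \<one>)) * (R (?w, \<one>) * R (\<beta>, h))"
    by simp
  also have "\<dots> = R (\<alpha>, g) * (R (?v, \<one>) * R (?w, \<one>)) * R (\<beta>, h)"
    by (simp only: mult.assoc)
  finally have eq: "R (\<alpha>, g) * R (\<beta>, h) = R (\<alpha>, g) * (R (?v, \<one>) * R (?w, \<one>)) * R (\<beta>, h)" .
  have zero: "R (?v, \<one>) * R (?w, \<one>) = 0"
    using cat_rep_Obj_orthogonal[OF cat_rep_restrict_one[OF cat_rep] o ne] o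
    by (simp add: Obj_in_Mor)
  show ?thesis unfolding eq zero by simp
qed

text \<open>
  The morphism \<open>(v, g)\<close> is invertible with inverse \<open>(g\<^sup>-\<^sup>1v, g\<^sup>-\<^sup>1)\<close>, and invertible morphisms are
  represented by partial isometries whose adjoint represents the inverse.
\<close>

lemma star_Obj:
  assumes v: "v \<in> Obj C" and g: "g \<in> carrier G"
  shows "(R (v, g))\<^sup>\<star> = R (act (inv g) v, inv g)"
proof -
  let ?w = "act (inv g) v"
  have w: "?w \<in> Obj C" using v g by (simp add: act_Obj)
  have m: "v \<in> Mor C" "?w \<in> Mor C" using v w by (simp_all add: Obj_in_Mor)
  have proj: "(R (v, \<one>))\<^sup>\<star> = R (v, \<one>)"
    using cat_rep_Obj_projection(1)[OF cat_rep_restrict_one[OF cat_rep] v] m by simp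
  have "R (?w, inv g) = R (?w, \<one>) * R (?w, inv g)"
    using mult_Obj[of ?w \<one> "inv g"] g w m by (simp add: src_Obj act_one)
  also have "\<dots> = (R (v, g))\<^sup>\<star> * (R (v, g) * R (?w, inv g))"
    using star_mult_self[of v g] v g m by (simp add: src_Obj flip: mult.assoc)
  also have "R (v, g) * R (?w, inv g) = R (v, \<one>)"
    using mult_Obj[of v g "inv g"] v g m by (simp add: src_Obj)
  also have "(R (v, g))\<^sup>\<star> * R (v, \<one>) = (R (v, \<one>) * R (v, g))\<^sup>\<star>"
    by (simp add: star_mult proj)
  also have "R (v, \<one>) * R (v, g) = R (v, g)"
    using mult_Obj[of v \<one> g] v g m by (simp add: src_Obj act_one)
  finally show ?thesis ..
qed

lemma Obj_sums: "((\<lambda>v. R (v, \<one>) * b) has_sum b) (Obj C)" "((\<lambda>v. b * R (v, \<one>)) has_sum b) (Obj C)"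
  using nondegenerate[unfolded nondegenerate_zappa_szep] by (simp_all add: nondegenerate_iff)

text \<open>
  The elements \<open>R\<^bsub>(v,g)\<^esub>\<close> are partial isometries with orthogonal ranges and with source projections
  \<open>R\<^bsub>(g\<^sup>-\<^sup>1v,1)\<^esub>\<close>. A finite sum \<open>S\<close> of them and the sum \<open>P\<close> of their source projections satisfy
  \<open>S\<^sup>\<star> S = P\<^sup>\<star> P\<close>, so partial sums of the series have the norms of partial sums of the
  series \<open>\<Sum>\<^sub>w R\<^bsub>(w,1)\<^esub> b\<close>, which converges by nondegeneracy.
\<close>

lemma summable_left:
  assumes g: "g \<in> carrier G"
  shows "(\<lambda>v. R (v, g) * b) summable_on Obj C"
proof (rule summable_on_dominated_partial_sums)
  let ?\<sigma> = "act (inv g)"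
  have bij: "bij_betw ?\<sigma> (Obj C) (Obj C)" using g by (simp add: bij_betw_act_Obj)
  show "(\<lambda>v. R (?\<sigma> v, \<one>) * b) summable_on Obj C"
    unfolding summable_on_reindex_bij_betw[OF bij, of "\<lambda>v. R (v, \<one>) * b"]
    using Obj_sums(1)[of b] by (rule has_sum_imp_summable)
  fix F
  assume F: "finite F" "F \<subseteq> Obj C"
  have o: "v \<in> Obj C" "v \<in> Mor C" "?\<sigma> v \<in> Obj C" "?\<sigma> v \<in> Mor C" if "v \<in> F" for v
    using F that g by (auto simp: Obj_in_Mor act_Obj)
  have "(\<Sum>v\<in>F. R (v, g))\<^sup>\<star> * (\<Sum>v\<in>F. R (v, g)) = (\<Sum>v\<in>F. (R (v, g))\<^sup>\<star> * R (v, g))"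
  proof (rule star_sum_mult_sum_orthogonal[OF F(1)])
    fix v w
    assume vw: "v \<in> F" "w \<in> F" "v \<noteq> w"
    then show "(R (v, g))\<^sup>\<star> * R (w, g) = 0"
      using o[OF vw(1)] o[OF vw(2)] g mult_eq_zero[of "?\<sigma> v" "inv g" w g]
      by (simp add: star_Obj src_Obj rng_Obj act_act_inv)
  qed
  also have "\<dots> = (\<Sum>v\<in>F. (R (?\<sigma> v, \<one>))\<^sup>\<star> * R (?\<sigma> v, \<one>))"
    using o g by (intro sum.cong refl) (simp add: star_mult_self src_Obj act_one)
  also have "\<dots> = (\<Sum>v\<in>F. R (?\<sigma> v, \<one>))\<^sup>\<star> * (\<Sum>v\<in>F. R (?\<sigma> v, \<one>))"
  proof (rule star_sum_mult_sum_orthogonal[OF F(1), symmetric])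
    fix v w
    assume vw: "v \<in> F" "w \<in> F" "v \<noteq> w"
    then have "?\<sigma> v \<noteq> ?\<sigma> w" using F(2) bij by (auto simp: bij_betw_def inj_on_def)
    then show "(R (?\<sigma> v, \<one>))\<^sup>\<star> * R (?\<sigma> w, \<one>) = 0"
      using o[OF vw(1)] o[OF vw(2)] mult_eq_zero[of "?\<sigma> v" \<one> "?\<sigma> w" \<one>]
      by (simp add: star_Obj src_Obj rng_Obj act_one)
  qed
  finally have "norm ((\<Sum>v\<in>F. R (v, g)) * b) = norm ((\<Sum>v\<in>F. R (?\<sigma> v, \<one>)) * b)"
    by (rule norm_mult_eq_if_star_mult_eq)
  then show "norm (\<Sum>v\<in>F. R (v, g) * b) \<le> norm (\<Sum>v\<in>F. R (?\<sigma> v, \<one>) * b)"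
    by (simp add: sum_distrib_right)
qed

text \<open>Taking adjoints turns this series into the previous one for \<open>g\<^sup>-\<^sup>1\<close>, reindexed along \<open>v \<mapsto> g\<^sup>-\<^sup>1v\<close>.\<close>

lemma summable_right:
  assumes g: "g \<in> carrier G"
  shows "(\<lambda>v. b * R (v, g)) summable_on Obj C"
proof -
  have "(\<lambda>v. (R (v, inv g) * b\<^sup>\<star>)\<^sup>\<star>) summable_on Obj C"
    using g by (intro summable_on_bounded_linear[OF bounded_linear_star] summable_left) simp
  then have "(\<lambda>v. (R (act (inv g) v, inv g) * b\<^sup>\<star>)\<^sup>\<star>) summable_on Obj C"
    using summable_on_reindex_bij_betw[OF bij_betw_act_Obj[of "inv g"],
        of "\<lambda>v. (R (v, inv g) * b\<^sup>\<star>)\<^sup>\<star>"] g by simp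
  then show ?thesis
    by (rule iffD1[OF summable_on_cong, rotated])
      (simp add: star_mult star_star g flip: star_Obj)
qed

text \<open>
  The pointwise sums of the left and right products form a double centralizer because
  \<open>a (R\<^bsub>(v,g)\<^esub> b) = (a R\<^bsub>(v,g)\<^esub>) b\<close> holds term by term.
\<close>

lemma strict_summable:
  assumes g: "g \<in> carrier G"
  shows "strict_summable (\<lambda>v. embM (R (v, g))) (Obj C)"
proof -
  define L where "L b = (\<Sum>\<^sub>\<infinity>v\<in>Obj C. R (v, g) * b)" for b
  define L' where "L' b = (\<Sum>\<^sub>\<infinity>v\<in>Obj C. b * R (v, g))" for b
  have L: "((\<lambda>v. R (v, g) * b) has_sum L b) (Obj C)" for b
    unfolding L_def using summable_left[OF g] by simp
  have L': "((\<lambda>v. b * R (v, g)) has_sum L' b) (Obj C)" for b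
    unfolding L'_def using summable_right[OF g] by simp
  have "a * L b = L' a * b" for a b
  proof (rule has_sum_unique)
    show "((\<lambda>v. a * (R (v, g) * b)) has_sum a * L b) (Obj C)"
      by (rule has_sum_bounded_linear[OF bounded_linear_mult_right L])
    show "((\<lambda>v. a * (R (v, g) * b)) has_sum L' a * b) (Obj C)"
      using has_sum_bounded_linear[OF bounded_linear_mult_left L'] by (simp add: mult.assoc)
  qed
  then obtain m where "\<And>b. lmul m b = L b" "\<And>b. rmul b m = L' b"
    using ex_multiplier[of L L'] by blast
  then have "strict_has_sum (\<lambda>v. embM (R (v, g))) m (Obj C)"
    using L L' by (simp add: strict_has_sum_iff lmul_embM rmul_embM)
  then show ?thesis unfolding strict_summable_def ..
qed

definition U :: "'g \<Rightarrow> 'b multiplier" where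
  "U g = strict_sum (\<lambda>v. embM (R (v, g))) (Obj C)"

lemma U_sums:
  assumes g: "g \<in> carrier G"
  shows "((\<lambda>v. R (v, g) * b) has_sum lmul (U g) b) (Obj C)"
    and "((\<lambda>v. b * R (v, g)) has_sum rmul b (U g)) (Obj C)"
proof -
  obtain m where m: "strict_has_sum (\<lambda>v. embM (R (v, g))) m (Obj C)"
    using strict_summable[OF g] by (auto simp: strict_summable_def)
  then have "U g = m" unfolding U_def by (rule strict_sum_eqI)
  with m have "strict_has_sum (\<lambda>v. embM (R (v, g))) (U g) (Obj C)" by simp
  then show "((\<lambda>v. R (v, g) * b) has_sum lmul (U g) b) (Obj C)"
    and "((\<lambda>v. b * R (v, g)) has_sum rmul b (U g)) (Obj C)"
    by (simp_all add: strict_has_sum_iff lmul_embM rmul_embM)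
qed

text \<open>The only vertex \<open>v\<close> for which \<open>R\<^bsub>(\<alpha>,g)\<^esub> R\<^bsub>(v,h)\<^esub>\<close> does not vanish is \<open>g\<^sup>-\<^sup>1s(\<alpha>)\<close>.\<close>

lemma rmul_U:
  assumes m: "\<alpha> \<in> Mor C" "g \<in> carrier G" "h \<in> carrier G"
  shows "rmul (R (\<alpha>, g)) (U h) = R (\<alpha>, g \<otimes> h)"
proof -
  let ?w = "act (inv g) (src C \<alpha>)"
  have "R (\<alpha>, g) * R (v, h) = 0" if "v \<in> Obj C" "v \<noteq> ?w" for v
    using m that by (intro mult_eq_zero) (auto simp: rng_Obj Obj_in_Mor)
  then have "((\<lambda>v. R (\<alpha>, g) * R (v, h)) has_sum R (\<alpha>, g) * R (?w, h)) (Obj C)"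
    using m by (intro has_sum_single[of ?w]) (auto simp: act_Obj src_closed)
  from has_sum_unique[OF U_sums(2)[OF m(3)] this] show ?thesis
    using m by (simp add: mult_Obj)
qed

text \<open>The only vertex \<open>v\<close> for which \<open>R\<^bsub>(v,g)\<^esub> R\<^bsub>(\<alpha>,h)\<^esub>\<close> does not vanish is \<open>g r(\<alpha>)\<close>.\<close>

lemma lmul_U:
  assumes m: "\<alpha> \<in> Mor C" "g \<in> carrier G" "h \<in> carrier G"
  shows "lmul (U g) (R (\<alpha>, h)) = R (act g \<alpha>, \<phi> g \<alpha> \<otimes> h)"
proof -
  let ?w = "act g (rng C \<alpha>)"
  have "R (v, g) * R (\<alpha>, h) = 0" if v: "v \<in> Obj C" "v \<noteq> ?w" for v
  proof (rule mult_eq_zero)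
    show "act (inv g) (src C v) \<noteq> rng C \<alpha>"
      using v m act_act_inv[of g v] by (auto simp: src_Obj Obj_in_Mor)
  qed (use v m in \<open>auto simp: Obj_in_Mor\<close>)
  then have "((\<lambda>v. R (v, g) * R (\<alpha>, h)) has_sum R (?w, g) * R (\<alpha>, h)) (Obj C)"
    using m by (intro has_sum_single[of ?w]) (auto simp: act_Obj rng_closed)
  from has_sum_unique[OF U_sums(1)[OF m(2)] this] show ?thesis
    using m by (simp add: Obj_mult)
qed

lemma multiplier_eqI_Obj:
  assumes "\<And>v. v \<in> Obj C \<Longrightarrow> rmul (R (v, \<one>)) m = rmul (R (v, \<one>)) n"
  shows "m = n"
  using nondegenerate[unfolded nondegenerate_zappa_szep] assms
  by (rule multiplier_eqI_nondegenerate)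

lemma U_one: "U \<one> = 1"
  by (rule multiplier_eqI_Obj) (simp add: rmul_U rmul_simps Obj_in_Mor)

lemma U_mult: "g \<in> carrier G \<Longrightarrow> h \<in> carrier G \<Longrightarrow> U (g \<otimes> h) = U g * U h"
  by (rule multiplier_eqI_Obj) (simp add: rmul_U rmul_simps Obj_in_Mor)

lemma U_star:
  assumes g: "g \<in> carrier G"
  shows "(U g)\<^sup>\<star> = U (inv g)"
proof (rule multiplier_eqI_Obj)
  fix v
  assume v: "v \<in> Obj C"
  have "rmul (R (v, \<one>)) ((U g)\<^sup>\<star>) = (lmul (U g) (R (v, \<one>)))\<^sup>\<star>"
    using star_Obj[OF v, of \<one>] v by (simp add: rmul_simps Obj_in_Mor act_one)
  also have "\<dots> = (R (act g v, g))\<^sup>\<star>"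
    using v g by (simp add: lmul_U Obj_in_Mor cocycle_Obj)
  also have "\<dots> = R (v, inv g)"
    using v g by (simp add: star_Obj act_Obj act_inv_act Obj_in_Mor)
  also have "\<dots> = rmul (R (v, \<one>)) (U (inv g))"
    using v g by (simp add: rmul_U Obj_in_Mor)
  finally show "rmul (R (v, \<one>)) ((U g)\<^sup>\<star>) = rmul (R (v, \<one>)) (U (inv g))" .
qed

lemma zs_to_system_eq: "zs_to_system C G R = (\<lambda>\<alpha>\<in>Mor C. R (\<alpha>, \<one>), \<lambda>g\<in>carrier G. U g)"
  by (simp add: zs_to_system_def U_def)

lemma zs_to_system_in_system_reps: "zs_to_system C G R \<in> system_reps C G act \<phi>"
proof -
  have "nondegenerate C (\<lambda>\<alpha>\<in>Mor C. R (\<alpha>, \<one>)) \<longleftrightarrow> nondegenerate C (\<lambda>\<alpha>. R (\<alpha>, \<one>))"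
    unfolding nondegenerate_iff
    by (intro all_cong1 conj_cong has_sum_cong) (simp_all add: Obj_in_Mor)
  then have "(\<lambda>\<alpha>\<in>Mor C. R (\<alpha>, \<one>)) \<in> nondeg_reps C"
    using nondegenerate cat_rep_restrict_one[OF cat_rep]
    by (simp add: nondeg_reps_def nondegenerate_zappa_szep)
  moreover have "(\<lambda>g\<in>carrier G. U g) \<in> hom G unitary_group"
    by (auto simp: hom_def unitary_group_def U_star U_one simp flip: U_mult)
  ultimately show ?thesis
    by (auto simp: zs_to_system_eq system_reps_def lmul_U rmul_U act_Mor cocycle_closed)
qed

lemma system_to_zs_inverse: "system_to_zs C G (zs_to_system C G R) = R"
proof (rule extensionalityI)
  show "R \<in> extensional (Mor C \<times> carrier G)"
    using cat_repD(1)[OF cat_rep] by (simp add: zappa_szep_simps)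
qed (auto simp: system_to_zs_def zs_to_system_eq rmul_U)

end

theorem theorem5p2:
  fixes C :: "'c smallcat" and G :: "'g monoid"
    and act :: "'g \<Rightarrow> 'c \<Rightarrow> 'c" and \<phi> :: "'g \<Rightarrow> 'c \<Rightarrow> 'g"
  assumes "category_system C G act \<phi>"
    and "left_cancellative C"
    and "finitely_aligned C"
  shows "bij_betw (system_to_zs C G)
           (system_reps C G act \<phi> ::
              (('c \<Rightarrow> 'b::cstar_algebra) \<times> ('g \<Rightarrow> 'b multiplier)) set)
           (nondeg_reps (zappa_szep C G act \<phi>))
       \<and> (\<forall>R \<in> (nondeg_reps (zappa_szep C G act \<phi>) :: ('c \<times> 'g \<Rightarrow> 'b) set).
            (\<forall>g\<in>carrier G. strict_summable (\<lambda>v. embM (R (v, g))) (Obj C))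
          \<and> zs_to_system C G R \<in> system_reps C G act \<phi>
          \<and> system_to_zs C G (zs_to_system C G R) = R)
       \<and> (\<forall>TU \<in> (system_reps C G act \<phi> ::
              (('c \<Rightarrow> 'b) \<times> ('g \<Rightarrow> 'b multiplier)) set).
            zs_to_system C G (system_to_zs C G TU) = TU)"
proof -
  interpret category_system C G act \<phi> by fact
  have summable: "\<And>g. g \<in> carrier G \<Longrightarrow> strict_summable (\<lambda>v. embM (R (v, g))) (Obj C)"
    and closed_back: "zs_to_system C G R \<in> system_reps C G act \<phi>"
    and right_inverse: "system_to_zs C G (zs_to_system C G R) = R"
    if R: "R \<in> nondeg_reps D" for R :: "'c \<times> 'g \<Rightarrow> 'b"
  proof -
    interpret zappa_szep_rep C G act \<phi> R
      by unfold_locales (use R in \<open>simp_all add: nondeg_reps_def\<close>)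
    show "strict_summable (\<lambda>v. embM (R (v, g))) (Obj C)" if "g \<in> carrier G" for g
      using that by (rule strict_summable)
    show "zs_to_system C G R \<in> system_reps C G act \<phi>"
      by (rule zs_to_system_in_system_reps)
    show "system_to_zs C G (zs_to_system C G R) = R"
      by (rule system_to_zs_inverse)
  qed
  have closed: "system_to_zs C G TU \<in> nondeg_reps D"
    and left_inverse: "zs_to_system C G (system_to_zs C G TU) = TU"
    if TU: "TU \<in> system_reps C G act \<phi>" for TU :: "('c \<Rightarrow> 'b) \<times> ('g \<Rightarrow> 'b multiplier)"
  proof -
    obtain T U where eq: "TU = (T, U)" by (rule prod.exhaust)
    show "system_to_zs C G TU \<in> nondeg_reps D"
      using TU unfolding eq by (rule system_to_zs_in_nondeg_reps)
    show "zs_to_system C G (system_to_zs C G TU) = TU"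
      using TU unfolding eq by (rule zs_to_system_inverse)
  qed
  have "bij_betw (system_to_zs C G)
      (system_reps C G act \<phi> :: (('c \<Rightarrow> 'b) \<times> ('g \<Rightarrow> 'b multiplier)) set) (nondeg_reps D)"
  proof (rule bij_betwI[where g = "zs_to_system C G"])
    show "system_to_zs C G \<in> system_reps C G act \<phi> \<rightarrow> (nondeg_reps D :: ('c \<times> 'g \<Rightarrow> 'b) set)"
      by (rule Pi_I) (rule closed)
    show "zs_to_system C G \<in> (nondeg_reps D :: ('c \<times> 'g \<Rightarrow> 'b) set) \<rightarrow> system_reps C G act \<phi>"
      by (rule Pi_I) (rule closed_back)
  qed (rule left_inverse right_inverse, assumption)+
  with summable closed_back right_inverse left_inverse show ?thesis by simp
qed

end
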